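(* Let $(X,d,\phi)$ be a flow and let $K\subset X$ be a non-empty compact subset. Then $$\overline{\mathrm{mdim}}^B(\phi,K,d)=\limsup_{\epsilon\to0}\frac{1}{\log\frac1\epsilon}\sup\{\underline{h}^{BK}_\mu(\phi,\epsilon):\mu\in\mathcal{M}(X),\ \mu(K)=1\}.$$
   Context: A flow $(X,d,\phi)$: $(X,d)$ is a compact metric space and $\phi:X\times\mathbb{R}\to X$ is continuous with $\phi_t(x)=\phi(x,t)$, $\phi_0=\mathrm{id}$, $\phi_{t+s}=\phi_t\circ\phi_s$. $\mathcal{M}(X)$ is the set of Borel probability measures on $X$. For $x\in X$, $t>0$, $\epsilon>0$, the Bowen ball is $B_t(x,\epsilon,\phi)=\{y\in X: d(\phi_s x,\phi_s y)<\epsilon \text{ for all } 0\le s\le t\}$. Bowen upper metric mean dimension of a set $Z\subset X$: for $\lambda\in\mathbb{R}$, $N\in\mathbb{N}$, $\epsilon>0$, let $M(\phi,d,Z,\lambda,N,\epsilon)=\inf\sum_{i\in I}e^{-n_i\lambda}$, the infimum over all finite or countable families $\{B_{n_i}(x_i,\epsilon,\phi)\}_{i\in I}$ covering $Z$ with integers $n_i\ge N$; $M(\phi,d,Z,\lambda,\epsilon)=\lim_{N\to\infty}M(\phi,d,Z,\lambda,N,\epsilon)$; $M(\phi,d,Z,\epsilon)=\inf\{\lambda: M(\phi,d,Z,\lambda,\epsilon)=0\}=\sup\{\lambda:M(\phi,d,Z,\lambda,\epsilon)=+\infty\}$; and $\overline{\mathrm{mdim}}^B(\phi,Z,d)=\limsup_{\epsilon\to0}\frac{M(\phi,d,Z,\epsilon)}{\log(1/\epsilon)}$.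 Lower Brin–Katok local entropy: for $\mu\in\mathcal{M}(X)$, $\underline{h}^{BK}_\mu(\phi,\epsilon)=\int\liminf_{t\to\infty}-\frac1t\log\mu(B_t(x,\epsilon,\phi))\,d\mu(x)$. *)

theory Defs
  imports "HOL-Probability.Probability"
begin

definition is_flow :: "'a::metric_space set \<Rightarrow> ('a \<Rightarrow> real \<Rightarrow> 'a) \<Rightarrow> bool" where
  "is_flow X \<phi> \<longleftrightarrow> compact X \<and>
     (\<forall>x\<in>X. \<forall>t. \<phi> x t \<in> X) \<and>
     continuous_on (X \<times> UNIV) (\<lambda>(x, t). \<phi> x t) \<and>
     (\<forall>x\<in>X. \<phi> x 0 = x) \<and>
     (\<forall>x\<in>X. \<forall>t s. \<phi> x (t + s) = \<phi> (\<phi> x s) t)"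

definition bowen_ball :: "'a::metric_space set \<Rightarrow> ('a \<Rightarrow> real \<Rightarrow> 'a) \<Rightarrow> real \<Rightarrow> 'a \<Rightarrow> real \<Rightarrow> 'a set" where
  "bowen_ball X \<phi> t x \<epsilon> = {y \<in> X. \<forall>s. 0 \<le> s \<and> s \<le> t \<longrightarrow> dist (\<phi> x s) (\<phi> y s) < \<epsilon>}"

definition prob_measures :: "'a::metric_space set \<Rightarrow> 'a measure set" where
  "prob_measures X = {\<mu>. prob_space \<mu> \<and> sets \<mu> = sets (restrict_space borel X)}"

text \<open>M(phi,d,Z,lambda,N,eps): infimum over countable (finite or infinite) families of Bowen
  balls B_{n}(x,eps) with x in X, integer n >= N, covering Z, of sum of exp(-n lambda).
  A family is represented by its (countable) set of index pairs (centre, n).\<close>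
definition bowen_M_N :: "'a::metric_space set \<Rightarrow> ('a \<Rightarrow> real \<Rightarrow> 'a) \<Rightarrow> 'a set \<Rightarrow> real \<Rightarrow> nat \<Rightarrow> real \<Rightarrow> ennreal" where
  "bowen_M_N X \<phi> Z lam N \<epsilon> =
     (INF C \<in> {C. countable C \<and> C \<subseteq> X \<times> {N..} \<and>
                 Z \<subseteq> (\<Union>(x, n)\<in>C. bowen_ball X \<phi> (real n) x \<epsilon>)}.
        \<integral>\<^sup>+ p. ennreal (exp (- real (snd p) * lam)) \<partial>count_space C)"

definition bowen_M_lam :: "'a::metric_space set \<Rightarrow> ('a \<Rightarrow> real \<Rightarrow> 'a) \<Rightarrow> 'a set \<Rightarrow> real \<Rightarrow> real \<Rightarrow> ennreal" where
  "bowen_M_lam X \<phi> Z lam \<epsilon> = lim (\<lambda>N. bowen_M_N X \<phi> Z lam N \<epsilon>)"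

definition bowen_M :: "'a::metric_space set \<Rightarrow> ('a \<Rightarrow> real \<Rightarrow> 'a) \<Rightarrow> 'a set \<Rightarrow> real \<Rightarrow> ereal" where
  "bowen_M X \<phi> Z \<epsilon> = Inf (ereal ` {lam. bowen_M_lam X \<phi> Z lam \<epsilon> = 0})"

definition bowen_upper_mdim :: "'a::metric_space set \<Rightarrow> ('a \<Rightarrow> real \<Rightarrow> 'a) \<Rightarrow> 'a set \<Rightarrow> ereal" where
  "bowen_upper_mdim X \<phi> Z = Limsup (at_right 0) (\<lambda>\<epsilon>. bowen_M X \<phi> Z \<epsilon> / ereal (ln (1 / \<epsilon>)))"

definition bk_quot :: "'a::metric_space set \<Rightarrow> ('a \<Rightarrow> real \<Rightarrow> 'a) \<Rightarrow> 'a measure \<Rightarrow> real \<Rightarrow> 'a \<Rightarrow> real \<Rightarrow> ennreal" where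
  "bk_quot X \<phi> \<mu> \<epsilon> x t =
     (if measure \<mu> (bowen_ball X \<phi> t x \<epsilon>) = 0 then \<top>
      else ennreal (- (1 / t) * ln (measure \<mu> (bowen_ball X \<phi> t x \<epsilon>))))"

definition lower_BK_entropy :: "'a::metric_space set \<Rightarrow> ('a \<Rightarrow> real \<Rightarrow> 'a) \<Rightarrow> 'a measure \<Rightarrow> real \<Rightarrow> ennreal" where
  "lower_BK_entropy X \<phi> \<mu> \<epsilon> =
     (\<integral>\<^sup>+ x. Liminf at_top (\<lambda>t. bk_quot X \<phi> \<mu> \<epsilon> x t) \<partial>\<mu>)"

end

theory Submission
  imports Defs "HOL-Real_Asymp.Real_Asymp"
begin

text \<open>
  Write \<open>H(\<epsilon>)\<close> for the supremum of the lower Brin--Katok entropies at scale \<open>\<epsilon>\<close> and \<open>M(\<epsilon>)\<close> for the Bowen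
  entropy of \<open>K\<close>. Then \<open>M(6\<epsilon>) \<le> H(\<epsilon>) \<le> M(\<epsilon>/2)\<close>, and constant factors in \<open>\<epsilon>\<close> disappear after
  division by \<open>log (1/\<epsilon>)\<close>. The second inequality is the mass distribution principle. The first is a
  dynamical Frostman lemma: on finite nets of \<open>K\<close> one minimises a quadratic energy whose kernel adds up
  \<open>exp (n s)\<close> over the times \<open>n\<close> up to which two points stay \<open>\<epsilon>\<close>-close. The Euler--Lagrange conditions
  give the Frostman bound on the support of the minimiser, and they bound the energy through a
  Bowen cover extracted from maximal separated sets. A weak limit of the minimisers, obtained from
  Helly's theorem after coding \<open>K\<close> into the real line, is the required measure.
\<close>

section \<open>Energy minimisers on finite sets\<close>

definition energy :: "'a set \<Rightarrow> ('a \<Rightarrow> 'a \<Rightarrow> real) \<Rightarrow> ('a \<Rightarrow> real) \<Rightarrow> real" where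
  "energy F k w = (\<Sum>x\<in>F. \<Sum>y\<in>F. w x * w y * k x y)"

text \<open>The probability simplex over \<open>F\<close>, as functions on the whole type. Being 0
  off \<open>F\<close> makes it compact in the product topology and makes its members mass functions
  of pmfs.\<close>

definition weights :: "'a set \<Rightarrow> ('a \<Rightarrow> real) set" where
  "weights F = {w. (\<forall>x. 0 \<le> w x) \<and> (\<forall>x. x \<notin> F \<longrightarrow> w x = 0) \<and> sum w F = 1}"

text \<open>Tychonoff for a product of \<open>{0..1}\<close> and \<open>{0}\<close>, cut by the
  closed condition of total mass 1.\<close>

lemma compact_weights:
  assumes "finite F"
  shows "compact (weights F)"
proof -
  let ?S = "\<lambda>x. if x \<in> F then {0..1::real} else {0}"
  have "compactin (product_topology (\<lambda>i. euclidean) UNIV) (PiE UNIV ?S)"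
    by (auto simp: compactin_PiE)
  then have 1: "compact (PiE UNIV ?S)"
    by (simp add: euclidean_product_topology)
  have "closed {w. sum w F = (1::real)}"
    by (intro closed_Collect_eq continuous_on_sum continuous_on_product_coordinates continuous_on_const)
  then have "compact (PiE UNIV ?S \<inter> {w. sum w F = 1})"
    using 1 by blast
  also have "PiE UNIV ?S \<inter> {w. sum w F = 1} = weights F"
  proof (intro equalityI subsetI)
    fix w assume w: "w \<in> weights F"
    have "w x \<le> 1" if "x \<in> F" for x
      using member_le_sum[of x F w] w that assms by (auto simp: weights_def)
    then show "w \<in> PiE UNIV ?S \<inter> {w. sum w F = 1}"
      using w by (auto simp: weights_def)
  qed (fastforce simp: weights_def PiE_iff split: if_splits)
  finally show ?thesis .
qed

text \<open>Symmetry of the kernel merges the two mixed terms, so the first variation is twice the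
  potential of \<open>w\<close> integrated against \<open>v\<close>.\<close>

lemma energy_add_scaled:
  assumes sym: "\<And>x y. x \<in> F \<Longrightarrow> y \<in> F \<Longrightarrow> k x y = k y x"
  shows "energy F k (\<lambda>x. w x + t * v x)
    = energy F k w + 2 * t * (\<Sum>x\<in>F. v x * (\<Sum>y\<in>F. w y * k x y)) + t\<^sup>2 * energy F k v"
proof -
  have "(\<Sum>x\<in>F. \<Sum>y\<in>F. w x * v y * k x y) = (\<Sum>x\<in>F. \<Sum>y\<in>F. w y * v x * k y x)"
    by (rule sum.swap)
  also have "\<dots> = (\<Sum>x\<in>F. \<Sum>y\<in>F. v x * (w y * k x y))"
    by (intro sum.cong refl) (simp add: sym)
  finally have "(\<Sum>x\<in>F. \<Sum>y\<in>F. w x * v y * k x y) = (\<Sum>x\<in>F. \<Sum>y\<in>F. v x * (w y * k x y))" .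
  moreover have "energy F k (\<lambda>x. w x + t * v x) = energy F k w
      + t * (\<Sum>x\<in>F. \<Sum>y\<in>F. w x * v y * k x y)
      + t * (\<Sum>x\<in>F. \<Sum>y\<in>F. v x * (w y * k x y)) + t\<^sup>2 * energy F k v"
    by (simp add: energy_def sum_distrib_left sum.distrib[symmetric] algebra_simps power2_eq_square)
  ultimately show ?thesis
    by (simp add: sum_distrib_left[of "v _"])
qed

text \<open>Euler-Lagrange conditions: moving mass from the minimiser towards a point cannot lower
  the energy, so the potential is at least \<open>I\<close>. Its mean under \<open>w\<close> is
  exactly \<open>I\<close>, which forces equality wherever \<open>w\<close> is positive.\<close>

lemma energy_minimizer:
  assumes F: "finite F" "F \<noteq> {}" and sym: "\<And>x y. x \<in> F \<Longrightarrow> y \<in> F \<Longrightarrow> k x y = k y x"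
  obtains w I where "w \<in> weights F"
    "\<And>x. x \<in> F \<Longrightarrow> I \<le> (\<Sum>y\<in>F. w y * k x y)"
    "\<And>x. x \<in> F \<Longrightarrow> 0 < w x \<Longrightarrow> (\<Sum>y\<in>F. w y * k x y) = I"
proof -
  obtain a where "a \<in> F" using F by auto
  then have "(\<lambda>x. if x = a then 1 else 0) \<in> weights F"
    using F by (auto simp: weights_def)
  moreover have "continuous_on (weights F) (energy F k)"
    unfolding energy_def
    by (intro continuous_intros continuous_on_subset[OF continuous_on_product_coordinates]) auto
  ultimately obtain w where w: "w \<in> weights F" and min: "\<And>v. v \<in> weights F \<Longrightarrow> energy F k w \<le> energy F k v"
    using continuous_attains_inf[OF compact_weights[OF F(1)], of "energy F k"] by (metis empty_iff)
  define U where "U x = (\<Sum>y\<in>F. w y * k x y)" for x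
  define I where "I = energy F k w"
  have I: "I = (\<Sum>x\<in>F. w x * U x)"
    by (simp add: I_def energy_def U_def sum_distrib_left mult.assoc)
  have ge: "I \<le> U x" if x: "x \<in> F" for x
  proof (rule ccontr)
    assume "\<not> I \<le> U x"
    \<comment> \<open>The direction from \<open>w\<close> to the point mass at \<open>x\<close>;
      \<open>w + t * v\<close> is a convex combination for \<open>0 < t < 1\<close>.\<close>
    define v where "v y = (if y = x then 1 else 0) - w y" for y
    have inner: "(\<Sum>y\<in>F. v y * U y) = U x - I"
      using F x by (simp add: v_def I left_diff_distrib sum_subtractf if_distrib[of "\<lambda>u. u * _"] cong: if_cong)
    have "0 \<le> 2 * (U x - I) + t * energy F k v" if t: "0 < t" "t < 1" for t
    proof -
      have "w y + t * v y = (1 - t) * w y + t * (if y = x then 1 else 0)" for y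
        by (simp add: v_def algebra_simps)
      then have "(\<lambda>y. w y + t * v y) \<in> weights F"
        using w F x t by (auto simp: weights_def sum.distrib simp flip: sum_distrib_left)
      then have "0 \<le> t * (2 * (U x - I) + t * energy F k v)"
        using min[of "\<lambda>y. w y + t * v y"] 
        by (simp add: energy_add_scaled[of F k w t v, OF sym] inner distrib_left power2_eq_square
            mult.assoc mult.left_commute flip: U_def)
      then show ?thesis using t by (simp add: zero_le_mult_iff)
    qed
    \<comment> \<open>Letting t tend to 0 leaves the first-order term, which is negative by
      assumption.\<close>
    then have "eventually (\<lambda>t. 0 \<le> 2 * (U x - I) + t * energy F k v) (at_right 0)"
      unfolding eventually_at_right[OF zero_less_one] by (intro exI[of _ 1]) simp
    moreover have "((\<lambda>t. 2 * (U x - I) + t * energy F k v) \<longlongrightarrow> 2 * (U x - I) + 0 * energy F k v) (at_right 0)"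
      by (intro tendsto_intros)
    ultimately have "0 \<le> 2 * (U x - I) + 0 * energy F k v"
      by (intro tendsto_lowerbound[of _ _ "at_right (0::real)"]) auto
    with \<open>\<not> I \<le> U x\<close> show False by simp
  qed
  \<comment> \<open>Nonnegative terms with sum 0 all vanish.\<close>
  have "(\<Sum>x\<in>F. w x * (U x - I)) = (\<Sum>x\<in>F. w x * U x) - sum w F * I"
    by (simp add: right_diff_distrib sum_subtractf sum_distrib_right)
  also have "\<dots> = 0" using w I by (simp add: weights_def)
  finally have "\<forall>x\<in>F. w x * (U x - I) = 0"
    using sum_nonneg_eq_0_iff[of F "\<lambda>x. w x * (U x - I)"] F w ge by (auto simp: weights_def)
  then have eq: "U x = I" if "x \<in> F" "0 < w x" for x
    using that by force
  show ?thesis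
    using that[OF w ge[unfolded U_def] eq[unfolded U_def]] .
qed

lemma pmf_of_weights:
  assumes "finite F" "w \<in> weights F"
  obtains p where "pmf p = w" "set_pmf p \<subseteq> F" "\<And>A. measure (measure_pmf p) A = sum w (A \<inter> F)"
proof -
  have nn: "(\<integral>\<^sup>+x. ennreal (w x) \<partial>count_space UNIV) = 1"
  proof -
    have "(\<integral>\<^sup>+x. ennreal (w x) \<partial>count_space UNIV) = (\<Sum>x\<in>F. ennreal (w x))"
      using assms by (intro nn_integral_count_space') (auto simp: weights_def)
    also have "\<dots> = 1"
      using assms by (subst sum_ennreal) (auto simp: weights_def)
    finally show ?thesis .
  qed
  define p where "p = embed_pmf w"
  have p: "pmf p = w"
    unfolding p_def using nn assms by (intro ext pmf_embed_pmf) (auto simp: weights_def)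
  have supp: "set_pmf p \<subseteq> F"
    using assms by (auto simp: set_pmf_eq p weights_def)
  have "measure (measure_pmf p) A = sum w (A \<inter> F)" for A
  proof -
    have "measure (measure_pmf p) A = measure (measure_pmf p) (A \<inter> F)"
      using supp by (intro measure_pmf.finite_measure_eq_AE) (auto simp: AE_measure_pmf_iff)
    also have "\<dots> = sum w (A \<inter> F)"
      using assms by (simp add: measure_measure_pmf_finite p)
    finally show ?thesis .
  qed
  with p supp show ?thesis using that by blast
qed

section \<open>Weak limits on compact metric spaces\<close>

text \<open>The open-set part of the portmanteau theorem: the indicator of \<open>V\<close> is the
  pointwise limit of bounded continuous functions below it, whose integrals converge along the
  sequence.\<close>

lemma weak_conv_open_le:
  assumes \<mu>: "\<And>n. real_distribution (\<mu> n)" and M: "real_distribution M" and conv: "weak_conv_m \<mu> M"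
    and V: "open V" and le: "eventually (\<lambda>n. measure (\<mu> n) V \<le> C) sequentially"
  shows "measure M V \<le> C"
\<comment> \<open>Treated apart because \<open>infdist\<close> to the empty set is 0, so the
  approximants below would vanish.\<close>
proof (cases "V = UNIV")
  case True
  interpret M: real_distribution M by fact
  from le obtain n where n: "measure (\<mu> n) V \<le> C"
    by (auto simp: eventually_sequentially)
  interpret N: real_distribution "\<mu> n" by (rule \<mu>)
  show ?thesis using n True N.prob_space M.prob_space by simp
next
  case False
  interpret M: real_distribution M by fact
  define f where "f m x = min 1 (real m * infdist x (- V))" for m :: nat and x
  have f01: "0 \<le> f m x" "f m x \<le> 1" for m x
    by (auto simp: f_def infdist_nonneg)
  have cont: "isCont (f m) x" for m x
    unfolding f_def by (intro continuous_intros)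
  have fV: "f m x \<le> indicator V x" for m x
    using False by (auto simp: f_def indicator_def infdist_nonneg)
  have [measurable]: "f m \<in> borel_measurable borel" for m
    using cont by (intro borel_measurable_continuous_onI continuous_at_imp_continuous_on) auto
  have bound: "integral\<^sup>L M (f m) \<le> C" for m
  proof (rule tendsto_upperbound)
    show "(\<lambda>n. integral\<^sup>L (\<mu> n) (f m)) \<longlonglongrightarrow> integral\<^sup>L M (f m)"
      by (rule weak_conv_imp_integral_bdd_continuous_conv[OF \<mu> M conv cont, of _ 1]) (use f01 in auto)
    show "eventually (\<lambda>n. integral\<^sup>L (\<mu> n) (f m) \<le> C) sequentially"
      using le
    proof eventually_elim
      case (elim n)
      interpret N: real_distribution "\<mu> n" by (rule \<mu>)
      have "integral\<^sup>L (\<mu> n) (f m) \<le> (\<integral>x. indicator V x \<partial>\<mu> n)"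
        using V f01 fV
        by (intro integral_mono N.integrable_const_bound[where B = 1] AE_I2)
          (auto simp: abs_le_iff)
      then show ?case using elim V by simp
    qed
  qed simp
  have "(\<lambda>m. integral\<^sup>L M (f m)) \<longlonglongrightarrow> (\<integral>x. indicator V x \<partial>M)"
  proof (rule integral_dominated_convergence[where w = "\<lambda>_. 1"])
    show "AE x in M. (\<lambda>m. f m x) \<longlonglongrightarrow> indicator V x"
    proof (rule AE_I2)
      fix x
      show "(\<lambda>m. f m x) \<longlonglongrightarrow> indicator V x"
      proof (cases "x \<in> V")
        case True
        then have "0 < infdist x (- V)"
          using V False by (intro infdist_pos_not_in_closed) auto
        then have "eventually (\<lambda>m. 1 \<le> real m * infdist x (- V)) sequentially"
          by real_asymp
        then have "eventually (\<lambda>m. f m x = 1) sequentially"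
          by eventually_elim (simp add: f_def)
        then show ?thesis using True by (simp add: tendsto_eventually)
      next
        case False
        then show ?thesis by (simp add: f_def)
      qed
    qed
  qed (use f01 V in auto)
  then have "(\<lambda>m. integral\<^sup>L M (f m)) \<longlonglongrightarrow> measure M V"
    using V by simp
  then show ?thesis
    by (rule tendsto_upperbound) (use bound in auto)
qed

text \<open>Cantor coding: the digits of \<open>c x\<close> record which balls of a countable family contain \<open>x\<close>.\<close>

lemma compact_real_coding:
  fixes K :: "'a::metric_space set"
  assumes "compact K"
  obtains c :: "'a \<Rightarrow> real" where "\<And>x. c x \<in> {0..2}"
    "\<And>\<eta>. 0 < \<eta> \<Longrightarrow> \<exists>\<delta>>0. \<forall>x\<in>K. \<forall>y\<in>K. \<bar>c x - c y\<bar> < \<delta> \<longrightarrow> dist x y < \<eta>"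
proof -
  have "\<exists>F. finite F \<and> K \<subseteq> (\<Union>x\<in>F. ball x (1 / real (Suc j)))" for j
    using assms unfolding compact_eq_totally_bounded by simp
  then obtain F where F: "\<And>j. finite (F j)" "\<And>j. K \<subseteq> (\<Union>x\<in>F j. ball x (1 / real (Suc j)))"
    by metis
  \<comment> \<open>Adding the empty set makes the family nonempty, so that it can be enumerated by
    all naturals.\<close>
  define \<B> where "\<B> = (\<Union>j. (\<lambda>x. ball x (1 / real (Suc j))) ` F j) \<union> {{}}"
  have "countable \<B>"
    unfolding \<B>_def using F(1) by (intro countable_Un countable_UN) (auto intro: countable_finite)
  then obtain G :: "nat \<Rightarrow> 'a set" where G: "range G = \<B>"
    by (metis \<B>_def Un_empty insert_not_empty uncountable_def)
  define b where "b x k = (if x \<in> G k then 1 else 0::real)" for x k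
  define c where "c x = (\<Sum>k. b x k * (1/3)^k)" for x
  have summ: "summable (\<lambda>k. b x k * (1/3)^k)" for x
    by (rule summable_comparison_test[of _ "\<lambda>k. (1/3)^k"]) (auto simp: b_def)
  have sum3: "(\<lambda>k. (1/3::real)^k) sums (3/2)"
    using geometric_sums[of "1/3::real"] by simp
  have c02: "c x \<in> {0..2}" for x
  proof -
    have "0 \<le> c x" unfolding c_def by (rule suminf_nonneg[OF summ]) (auto simp: b_def)
    moreover have "c x \<le> 3/2"
      unfolding c_def
      by (rule sums_le[OF _ summable_sums[OF summ] sum3]) (auto simp: b_def)
    ultimately show ?thesis by simp
  qed
  \<comment> \<open>Base 3 with digits 0 and 1: the first differing digit contributes
    \<open>(1/3)^k\<close>, while both tails lie between 0 and half of that, so no cancellation can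
    occur.\<close>
  have far: "(1/3)^k / 2 \<le> \<bar>c x - c y\<bar>" if agree: "\<And>i. i < k \<Longrightarrow> b x i = b y i" and diff: "b x k \<noteq> b y k" for x y k
  proof -
    have split: "c z = (\<Sum>i<Suc k. b z i * (1/3)^i) + (\<Sum>i. b z (i + Suc k) * (1/3)^(i + Suc k))" for z
      unfolding c_def using suminf_split_initial_segment[OF summ, of z "Suc k"] by simp
    let ?r = "\<lambda>z. (\<Sum>i. b z (i + Suc k) * (1/3)^(i + Suc k))"
    have r: "0 \<le> ?r z \<and> ?r z \<le> (1/3)^k / 2" for z
    proof
      have s: "summable (\<lambda>i. b z (i + Suc k) * (1/3)^(i + Suc k))"
        using summ by (rule summable_ignore_initial_segment)
      show "0 \<le> ?r z" by (rule suminf_nonneg[OF s]) (auto simp: b_def)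
      have "(\<lambda>i. (1/3)^i * (1/3)^Suc k) sums (3/2 * (1/3::real)^Suc k)"
        by (rule sums_mult2[OF sum3])
      then have "?r z \<le> 3/2 * (1/3::real)^Suc k"
        by (rule sums_le[OF _ summable_sums[OF s], rotated]) (auto simp: b_def power_add)
      then show "?r z \<le> (1/3)^k / 2" by simp
    qed
    have "(\<Sum>i<k. b x i * (1/3)^i) = (\<Sum>i<k. b y i * (1/3)^i)"
      using agree by simp
    then have "c x - c y = (b x k - b y k) * (1/3)^k + (?r x - ?r y)"
      by (simp add: split algebra_simps)
    moreover have "\<bar>b x k - b y k\<bar> = 1" using diff by (auto simp: b_def split: if_splits)
    then have "\<bar>(b x k - b y k) * (1/3)^k\<bar> = (1/3)^k" by (simp add: abs_mult)
    ultimately show ?thesis using r[of x] r[of y] by (simp add: abs_if split: if_splits)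
  qed
  \<comment> \<open>Codes closer than \<open>(1/3)^k0 / 2\<close> share all digits below
    \<open>k0\<close>, a bound on the indices of the finitely many balls of radius
    \<open>1 / Suc j\<close>. One of these balls then contains both points.\<close>
  have near: "\<exists>\<delta>>0. \<forall>x\<in>K. \<forall>y\<in>K. \<bar>c x - c y\<bar> < \<delta> \<longrightarrow> dist x y < \<eta>" if "0 < \<eta>" for \<eta>
  proof -
    obtain j :: nat where j: "2 / real (Suc j) < \<eta>"
      using reals_Archimedean[of "\<eta> / 2"] \<open>0 < \<eta>\<close> by (auto simp: field_simps)
    have "\<forall>z\<in>F j. \<exists>k. G k = ball z (1 / real (Suc j))"
      using G unfolding \<B>_def by (metis (no_types, lifting) UN_I UNIV_I UnI1 image_iff)
    then obtain \<kappa> where \<kappa>: "\<And>z. z \<in> F j \<Longrightarrow> G (\<kappa> z) = ball z (1 / real (Suc j))"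
      by metis
    obtain k0 where k0: "\<And>z. z \<in> F j \<Longrightarrow> \<kappa> z < k0"
      using finite_nat_set_iff_bounded[of "\<kappa> ` F j"] F(1) by auto
    have "dist x y < \<eta>" if xy: "x \<in> K" "y \<in> K" "\<bar>c x - c y\<bar> < (1/3)^k0 / 2" for x y
    proof -
      have agree: "b x k = b y k" if "k < k0" for k
      proof (rule ccontr)
        assume "b x k \<noteq> b y k"
        define l where "l = (LEAST k. b x k \<noteq> b y k)"
        have "b x l \<noteq> b y l"
          unfolding l_def using \<open>b x k \<noteq> b y k\<close> by (rule LeastI)
        moreover have "b x i = b y i" if "i < l" for i
          using not_less_Least[of i "\<lambda>k. b x k \<noteq> b y k"] that unfolding l_def by blast
        ultimately have "(1/3)^l / 2 \<le> \<bar>c x - c y\<bar>" by (intro far)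
        moreover have "l \<le> k0"
          using \<open>b x k \<noteq> b y k\<close> that unfolding l_def by (intro order.trans[OF Least_le[of "\<lambda>k. b x k \<noteq> b y k" k]]) auto
        then have "(1/3::real)^k0 \<le> (1/3)^l" by (intro power_decreasing) auto
        ultimately show False using xy(3) by simp
      qed
      obtain z where z: "z \<in> F j" "x \<in> ball z (1 / real (Suc j))"
        using F(2)[of j] xy(1) by blast
      then have "x \<in> G (\<kappa> z)" using \<kappa> by simp
      with agree[OF k0[OF z(1)]] have "y \<in> G (\<kappa> z)" by (auto simp: b_def split: if_splits)
      then have "y \<in> ball z (1 / real (Suc j))" using \<kappa> z by simp
      then have "dist x y < 2 / real (Suc j)"
        using z(2) dist_triangle2[of x y z] by (simp add: dist_commute)
      with j show ?thesis by simp
    qed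
    then show ?thesis by (intro exI[of _ "(1/3)^k0 / 2"]) auto
  qed
  show ?thesis using that[OF c02 near] .
qed

lemma pmf_weak_limit_on_compact:
  fixes K X :: "'a::metric_space set" and p :: "nat \<Rightarrow> 'a pmf"
  assumes K: "compact K" "K \<noteq> {}" "K \<subseteq> X" and p: "\<And>T. set_pmf (p T) \<subseteq> K"
  obtains \<mu> where "\<mu> \<in> prob_measures X" "emeasure \<mu> K = 1"
    "\<And>U C. openin (top_of_set X) U \<Longrightarrow> eventually (\<lambda>T. measure (measure_pmf (p T)) U \<le> C) sequentially
      \<Longrightarrow> measure \<mu> U \<le> C"
proof -
  obtain c :: "'a \<Rightarrow> real" where c02: "\<And>x. c x \<in> {0..2}" and
    near: "\<And>\<eta>. 0 < \<eta> \<Longrightarrow> \<exists>\<delta>>0. \<forall>x\<in>K. \<forall>y\<in>K. \<bar>c x - c y\<bar> < \<delta> \<longrightarrow> dist x y < \<eta>"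
    using compact_real_coding[OF K(1)] by metis
  define \<nu> where "\<nu> T = distr (measure_pmf (p T)) borel c" for T
  have \<nu>: "real_distribution (\<nu> T)" for T
    unfolding \<nu>_def by (rule prob_space.real_distribution_distr[OF prob_space_measure_pmf]) simp
  have \<nu>_meas: "measure (\<nu> T) A = measure (measure_pmf (p T)) (c -` A)" if "A \<in> sets borel" for T A
    unfolding \<nu>_def using that by (subst measure_distr) auto
  have "tight \<nu>"
    unfolding tight_def
  proof (intro conjI allI impI)
    fix e :: real assume "0 < e"
    have "measure (\<nu> T) {-1<..2} = 1" for T
    proof -
      have "-1 < c x" "c x \<le> 2" for x
        using c02[of x] by auto
      then have "c -` {-1<..2} = UNIV" by auto
      then show ?thesis by (simp add: \<nu>_meas)
    qed
    then show "\<exists>a b. a < b \<and> (\<forall>n. 1 - e < measure (\<nu> n) {a<..b})"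
      using \<open>0 < e\<close> by (intro exI[of _ "-1"] exI[of _ 2]) simp
  qed (rule \<nu>)
  then obtain r M where r: "strict_mono r" and M: "real_distribution M" and conv: "weak_conv_m (\<nu> \<circ> id \<circ> r) M"
    using tight_imp_convergent_subsubsequence[of \<nu> id] by (auto simp: strict_mono_id)
  interpret M: real_distribution M by fact
  have limit: "measure M V \<le> C"
    if "open V" "eventually (\<lambda>T. measure (measure_pmf (p T)) (c -` V) \<le> C) sequentially" for V C
  proof (rule weak_conv_open_le[OF _ M conv that(1)])
    show "\<forall>\<^sub>F n in sequentially. measure ((\<nu> \<circ> id \<circ> r) n) V \<le> C"
      using eventually_compose_filterlim[OF that(2) filterlim_subseq[OF r]] that(1)
      by (simp add: \<nu>_meas)
  qed (simp add: \<nu>)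
  define Q where "Q = closure (c ` K)"
  have "\<exists>\<xi>. (\<forall>i. \<xi> i \<in> K) \<and> (\<lambda>i. c (\<xi> i)) \<longlonglongrightarrow> u \<and> (\<exists>x\<in>K. \<xi> \<longlonglongrightarrow> x)" if "u \<in> Q" for u
  proof -
    from that obtain v where v: "\<And>i. v i \<in> c ` K" "v \<longlonglongrightarrow> u"
      unfolding Q_def closure_sequential by blast
    then have "\<forall>i. \<exists>x. x \<in> K \<and> v i = c x" by blast
    then obtain \<xi> where \<xi>: "\<And>i. \<xi> i \<in> K" "\<And>i. v i = c (\<xi> i)"
      unfolding choice_iff by blast
    obtain x l where x: "x \<in> K" "strict_mono (l :: nat \<Rightarrow> nat)" "(\<xi> \<circ> l) \<longlonglongrightarrow> x"
      using K(1) \<xi>(1) unfolding compact_def by blast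
    have "(v \<circ> l) \<longlonglongrightarrow> u" using v(2) x(2) by (rule LIMSEQ_subseq_LIMSEQ)
    then show ?thesis
      using \<xi> x by (intro exI[of _ "\<xi> \<circ> l"]) (auto simp: comp_def)
  qed
  then obtain \<xi> g where \<xi>: "\<And>u i. u \<in> Q \<Longrightarrow> \<xi> u i \<in> K" "\<And>u. u \<in> Q \<Longrightarrow> (\<lambda>i. c (\<xi> u i)) \<longlonglongrightarrow> u"
    "\<And>u. u \<in> Q \<Longrightarrow> \<xi> u \<longlonglongrightarrow> g u" and gK: "\<And>u. u \<in> Q \<Longrightarrow> g u \<in> K"
    by metis
  \<comment> \<open>The modulus of continuity of the decoding passes to limits, with strict
    inequality weakened to \<open>\<le>\<close>.\<close>
  have unif: "dist (g u) (g v) \<le> \<eta>"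
    if uv: "u \<in> Q" "v \<in> Q" "\<bar>u - v\<bar> < \<delta>" and \<delta>: "\<forall>x\<in>K. \<forall>y\<in>K. \<bar>c x - c y\<bar> < \<delta> \<longrightarrow> dist x y < \<eta>" for u v \<delta> \<eta>
  proof (rule tendsto_upperbound)
    show "(\<lambda>i. dist (\<xi> u i) (\<xi> v i)) \<longlonglongrightarrow> dist (g u) (g v)"
      using \<xi> uv by (intro tendsto_intros)
    have "(\<lambda>i. \<bar>c (\<xi> u i) - c (\<xi> v i)\<bar>) \<longlonglongrightarrow> \<bar>u - v\<bar>"
      using \<xi> uv by (intro tendsto_intros)
    then have "eventually (\<lambda>i. \<bar>c (\<xi> u i) - c (\<xi> v i)\<bar> < \<delta>) sequentially"
      using uv(3) by (rule order_tendstoD)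
    then show "\<forall>\<^sub>F i in sequentially. dist (\<xi> u i) (\<xi> v i) \<le> \<eta>"
      by eventually_elim (use \<delta> \<xi>(1) uv in \<open>auto intro!: less_imp_le\<close>)
  qed simp
  have contg: "continuous_on Q g"
    unfolding continuous_on_iff
  proof (intro ballI allI impI)
    fix u \<eta> :: real assume u: "u \<in> Q" and "0 < \<eta>"
    then obtain \<delta> where "0 < \<delta>" and \<delta>: "\<forall>x\<in>K. \<forall>y\<in>K. \<bar>c x - c y\<bar> < \<delta> \<longrightarrow> dist x y < \<eta> / 2"
      using near[of "\<eta> / 2"] by auto
    have "dist (g v) (g u) < \<eta>" if "v \<in> Q" "dist v u < \<delta>" for v
      using unif[OF that(1) u _ \<delta>] that(2) \<open>0 < \<eta>\<close> by (simp add: dist_real_def)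
    with \<open>0 < \<delta>\<close> show "\<exists>d>0. \<forall>v\<in>Q. dist v u < d \<longrightarrow> dist (g v) (g u) < \<eta>" by blast
  qed
  \<comment> \<open>The sequence chosen for \<open>c x\<close> need not be constant, but its codes
    approach \<open>c x\<close>, so its terms approach \<open>x\<close>.\<close>
  have gc: "g (c x) = x" if x: "x \<in> K" for x
  proof -
    have Qx: "c x \<in> Q" using x unfolding Q_def by (intro subsetD[OF closure_subset] imageI)
    have "dist (g (c x)) x \<le> \<eta>" if \<eta>: "0 < \<eta>" for \<eta>
    proof -
      obtain \<delta> where "0 < \<delta>" and \<delta>: "\<forall>x\<in>K. \<forall>y\<in>K. \<bar>c x - c y\<bar> < \<delta> \<longrightarrow> dist x y < \<eta>"
        using near[OF \<eta>] by auto
      have "eventually (\<lambda>i. \<bar>c (\<xi> (c x) i) - c x\<bar> < \<delta>) sequentially"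
        using tendstoD[OF \<xi>(2)[OF Qx] \<open>0 < \<delta>\<close>] by (simp add: dist_real_def)
      then have "eventually (\<lambda>i. dist (\<xi> (c x) i) x \<le> \<eta>) sequentially"
        by eventually_elim (use \<delta> \<xi>(1)[OF Qx] x in \<open>auto intro!: less_imp_le\<close>)
      moreover have "(\<lambda>i. dist (\<xi> (c x) i) x) \<longlonglongrightarrow> dist (g (c x)) x"
        using \<xi>(3)[OF Qx] by (intro tendsto_intros)
      ultimately show ?thesis using tendsto_upperbound trivial_limit_sequentially by blast
    qed
    then have "dist (g (c x)) x \<le> 0" by (rule field_le_epsilon) simp
    then show ?thesis by simp
  qed
  obtain x0 where x0: "x0 \<in> K" using K by auto
  \<comment> \<open>The default \<open>x0\<close> keeps all values in \<open>K\<close>; it is only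
    used on a set that turns out to be \<open>M\<close>-null.\<close>
  define G where "G u = (if u \<in> Q then g u else x0)" for u
  have GK: "G u \<in> K" for u using gK x0 by (simp add: G_def)
  have Qc: "closed Q" by (simp add: Q_def)
  have G_borel: "G \<in> borel_measurable borel"
    unfolding G_def using Qc contg
    by (intro borel_measurable_continuous_on_if) auto
  have G[measurable]: "G \<in> measurable M (restrict_space borel X)"
    using G_borel GK K(3) by (intro measurable_restrict_space2) (auto cong: measurable_cong_sets)
  define \<mu> where "\<mu> = distr M (restrict_space borel X) G"
  have "K \<in> sets borel" using K(1) by (simp add: borel_compact)
  then have Ks: "K \<in> sets (restrict_space borel X)"
    using K(3) by (auto simp: sets_restrict_space)
  have prob: "prob_space \<mu>" unfolding \<mu>_def by (rule M.prob_space_distr[OF G])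
  have \<mu>K: "emeasure \<mu> K = 1"
  proof -
    have "G -` K \<inter> space M = space M" using GK by auto
    then show ?thesis unfolding \<mu>_def using Ks by (subst emeasure_distr[OF G]) (use M.emeasure_space_1 in simp_all)
  qed
  \<comment> \<open>The complement of \<open>Q\<close> is open and none of the approximating
    measures charges it.\<close>
  have MQ: "measure M (- Q) = 0"
  proof -
    have "measure (measure_pmf (p T)) (c -` (- Q)) = 0" for T
    proof -
      have "c -` (- Q) \<inter> set_pmf (p T) = {}"
        using p[of T] unfolding Q_def using closure_subset[of "c ` K"] by blast
      then show ?thesis by (simp add: measure_pmf_zero_iff Int_commute)
    qed
    then have "measure M (- Q) \<le> 0" using Qc by (intro limit) auto
    then show ?thesis by (simp add: measure_le_0_iff)
  qed
  have lim\<mu>: "measure \<mu> U \<le> C"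
    if U: "openin (top_of_set X) U" and ev: "eventually (\<lambda>T. measure (measure_pmf (p T)) U \<le> C) sequentially" for U C
  proof -
    obtain O' where O': "open O'" "U = X \<inter> O'" using U by (auto simp: openin_open)
    then have Us: "U \<in> sets (restrict_space borel X)" by (auto simp: sets_restrict_space)
    have "openin (top_of_set Q) (Q \<inter> g -` O')"
      using contg O'(1) by (rule continuous_openin_preimage_gen)
    \<comment> \<open>\<open>V\<close> is an open set of codes with the same trace on
      \<open>Q\<close> as the preimage of \<open>U\<close>. On \<open>K\<close>, membership of
      \<open>c x\<close> in \<open>V\<close> is membership of \<open>x\<close> in \<open>U\<close>,
      so the bound for \<open>U\<close> becomes a bound for \<open>V\<close>.\<close>
    then obtain V where V: "open V" "Q \<inter> g -` O' = Q \<inter> V" by (auto simp: openin_open)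
    have "measure \<mu> U = measure M (G -` U \<inter> space M)"
      unfolding \<mu>_def by (rule measure_distr[OF G Us])
    also have "\<dots> \<le> measure M (V \<union> - Q)"
    proof (rule M.finite_measure_mono)
      show "G -` U \<inter> space M \<subseteq> V \<union> - Q"
        using V(2) O'(2) by (auto simp: G_def split: if_splits)
    qed (use V Qc in auto)
    also have "\<dots> \<le> measure M V + measure M (- Q)"
      using V Qc by (intro measure_Un_le) auto
    also have "\<dots> \<le> C"
    proof -
      have "measure (measure_pmf (p T)) (c -` V) = measure (measure_pmf (p T)) U" for T
      proof (rule measure_pmf.finite_measure_eq_AE)
        have "x \<in> c -` V \<longleftrightarrow> x \<in> U" if "x \<in> K" for x
        proof -
          have "c x \<in> Q" using that closure_subset[of "c ` K"] unfolding Q_def by blast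
          then have "c x \<in> V \<longleftrightarrow> g (c x) \<in> O'" using V(2) by blast
          then show ?thesis using gc[OF that] O'(2) K(3) that by auto
        qed
        then show "AE x in measure_pmf (p T). (x \<in> c -` V) = (x \<in> U)"
          using p[of T] by (auto simp: AE_measure_pmf_iff)
      qed auto
      then have "measure M V \<le> C" using ev V(1) by (intro limit) auto
      then show ?thesis by (simp add: MQ)
    qed
    finally show ?thesis .
  qed
  show ?thesis
  proof (rule that[of \<mu>])
    show "\<mu> \<in> prob_measures X" using prob by (simp add: prob_measures_def \<mu>_def)
  qed (use \<mu>K lim\<mu> in auto)
qed

section \<open>Bowen balls and the mass distribution principle\<close>

text \<open>Countable subadditivity with the sum written as in the cost of a cover in
  \<open>bowen_M_N\<close>.\<close>

lemma emeasure_UN_le_count_space: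
  assumes I: "countable I" and A: "\<And>i. i \<in> I \<Longrightarrow> A i \<in> sets M"
  shows "emeasure M (\<Union>i\<in>I. A i) \<le> (\<integral>\<^sup>+ i. emeasure M (A i) \<partial>count_space I)"
proof -
  define J where "J = to_nat_on I ` I"
  define A' where "A' n = (if n \<in> J then A (from_nat_into I n) else {})" for n
  have bij: "bij_betw (from_nat_into I) J I"
    unfolding J_def using I by (auto simp: bij_betw_def inj_on_def image_image)
  have "emeasure M (\<Union>i\<in>I. A i) = emeasure M (\<Union>n. A' n)"
    using I by (intro arg_cong[where f = "emeasure M"]) (force simp: A'_def J_def)
  also have "\<dots> \<le> (\<Sum>n. emeasure M (A' n))"
    using A I by (intro emeasure_subadditive_countably) (auto simp: A'_def J_def)
  also have "\<dots> = (\<integral>\<^sup>+ n. emeasure M (A' n) \<partial>count_space UNIV)"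
    by (simp add: nn_integral_count_space_nat)
  also have "\<dots> = (\<integral>\<^sup>+ n. emeasure M (A (from_nat_into I n)) * indicator J n \<partial>count_space UNIV)"
    by (intro nn_integral_cong) (auto simp: A'_def)
  also have "\<dots> = (\<integral>\<^sup>+ n. emeasure M (A (from_nat_into I n)) \<partial>count_space J)"
    by (simp add: nn_integral_count_space_indicator)
  also have "\<dots> = (\<integral>\<^sup>+ i. emeasure M (A i) \<partial>count_space I)"
    by (rule nn_integral_bij_count_space[OF bij])
  finally show ?thesis .
qed

section \<open>Geometry and topology of Bowen balls\<close>

lemma bowen_ball_trans:
  "y \<in> bowen_ball X \<phi> t x a \<Longrightarrow> z \<in> bowen_ball X \<phi> t y b \<Longrightarrow> z \<in> bowen_ball X \<phi> t x (a + b)"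
  unfolding bowen_ball_def
  by (auto intro!: le_less_trans[OF dist_triangle[of "\<phi> x s" "\<phi> z s" "\<phi> y s" for s]] add_strict_mono)

lemma bowen_ball_sym:
  "x \<in> X \<Longrightarrow> y \<in> bowen_ball X \<phi> t x a \<Longrightarrow> x \<in> bowen_ball X \<phi> t y a"
  by (simp add: bowen_ball_def dist_commute)

lemma bowen_ball_center: "x \<in> X \<Longrightarrow> 0 < a \<Longrightarrow> x \<in> bowen_ball X \<phi> t x a"
  by (simp add: bowen_ball_def)

lemma bowen_ball_antimono_time: "t' \<le> t \<Longrightarrow> bowen_ball X \<phi> t x a \<subseteq> bowen_ball X \<phi> t' x a"
  by (auto simp: bowen_ball_def)

lemma bowen_ball_mono_radius: "a \<le> b \<Longrightarrow> bowen_ball X \<phi> t x a \<subseteq> bowen_ball X \<phi> t x b"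
  by (force simp: bowen_ball_def)

lemma bowen_ball_subset: "bowen_ball X \<phi> t x a \<subseteq> X"
  by (auto simp: bowen_ball_def)

text \<open>Heine-Cantor on the compact product of \<open>X\<close> with
  \<open>{0..t}\<close>.\<close>

lemma flow_equicontinuous:
  assumes flow: "is_flow X \<phi>" and "0 < \<eta>"
  obtains \<delta> where "0 < \<delta>" "\<And>x y. x \<in> X \<Longrightarrow> y \<in> X \<Longrightarrow> dist x y < \<delta> \<Longrightarrow> y \<in> bowen_ball X \<phi> t x \<eta>"
proof -
  have "continuous_on (X \<times> {0..t}) (\<lambda>(x, t). \<phi> x t)"
    using flow unfolding is_flow_def by (elim conjE continuous_on_subset) auto
  moreover have "compact (X \<times> {0..t})"
    using flow by (intro compact_Times) (auto simp: is_flow_def)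
  ultimately have "uniformly_continuous_on (X \<times> {0..t}) (\<lambda>(x, t). \<phi> x t)"
    by (rule compact_uniformly_continuous)
  then obtain \<delta> where "0 < \<delta>" and
    \<delta>: "\<And>p q. p \<in> X \<times> {0..t} \<Longrightarrow> q \<in> X \<times> {0..t} \<Longrightarrow> dist q p < \<delta> \<Longrightarrow>
      dist (case q of (x, t) \<Rightarrow> \<phi> x t) (case p of (x, t) \<Rightarrow> \<phi> x t) < \<eta>"
    using \<open>0 < \<eta>\<close> by (rule uniformly_continuous_onE) metis
  have "y \<in> bowen_ball X \<phi> t x \<eta>" if "x \<in> X" "y \<in> X" "dist x y < \<delta>" for x y
    using that \<delta>[of "(y, _)" "(x, _)"] by (auto simp: bowen_ball_def dist_Pair_Pair)
  with \<open>0 < \<delta>\<close> show ?thesis using that by blast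
qed

text \<open>The distance of the two orbits attains its maximum \<open>m < \<epsilon>\<close> on
  \<open>{0..t}\<close>, and the midpoint of \<open>m\<close> and \<open>\<epsilon>\<close> still
  exceeds \<open>m\<close>.\<close>

lemma bowen_ball_slack:
  assumes flow: "is_flow X \<phi>" and x: "x \<in> X" and y: "y \<in> bowen_ball X \<phi> t x \<epsilon>"
  obtains \<epsilon>' where "\<epsilon>' < \<epsilon>" "y \<in> bowen_ball X \<phi> t x \<epsilon>'"
proof (cases "0 \<le> t")
  case True
  have yX: "y \<in> X" using y bowen_ball_subset by blast
  have cont: "continuous_on {0..t} (\<phi> z)" if "z \<in> X" for z
  proof -
    have "continuous_on {0..t} ((\<lambda>(x, t). \<phi> x t) \<circ> (\<lambda>s. (z, s)))"
      using flow that unfolding is_flow_def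
      by (intro continuous_on_compose continuous_intros) (auto elim: continuous_on_subset)
    then show ?thesis by (simp add: comp_def)
  qed
  have "continuous_on {0..t} (\<lambda>s. dist (\<phi> x s) (\<phi> y s))"
    by (intro continuous_on_dist cont x yX)
  then obtain s where s: "s \<in> {0..t}" and max: "\<And>s'. s' \<in> {0..t} \<Longrightarrow> dist (\<phi> x s') (\<phi> y s') \<le> dist (\<phi> x s) (\<phi> y s)"
    using continuous_attains_sup[of "{0..t}" "\<lambda>s. dist (\<phi> x s) (\<phi> y s)"] True by auto
  define m where "m = dist (\<phi> x s) (\<phi> y s)"
  have "m < \<epsilon>" using y s by (auto simp: m_def bowen_ball_def)
  then show ?thesis
    using max yX
    by (intro that[of "(m + \<epsilon>) / 2"]) (force simp: bowen_ball_def m_def[symmetric] field_simps)+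
next
  \<comment> \<open>For negative \<open>t\<close> no time is tested and every radius gives all of
    \<open>X\<close>.\<close>
  case False
  then show ?thesis using y by (intro that[of "\<epsilon> - 1"]) (auto simp: bowen_ball_def)
qed

text \<open>The slack \<open>\<epsilon> - \<epsilon>'\<close> at a point absorbs small displacements
  of that point, by equicontinuity up to time \<open>t\<close>.\<close>

lemma openin_bowen_ball:
  assumes flow: "is_flow X \<phi>" and x: "x \<in> X"
  shows "openin (top_of_set X) (bowen_ball X \<phi> t x \<epsilon>)"
  unfolding openin_euclidean_subtopology_iff
proof (intro conjI ballI bowen_ball_subset)
  fix y assume y: "y \<in> bowen_ball X \<phi> t x \<epsilon>"
  obtain \<epsilon>' where \<epsilon>': "\<epsilon>' < \<epsilon>" "y \<in> bowen_ball X \<phi> t x \<epsilon>'"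
    by (rule bowen_ball_slack[OF flow x y])
  obtain \<delta> where \<delta>: "0 < \<delta>" "\<And>x y. x \<in> X \<Longrightarrow> y \<in> X \<Longrightarrow> dist x y < \<delta> \<Longrightarrow> y \<in> bowen_ball X \<phi> t x (\<epsilon> - \<epsilon>')"
    using flow_equicontinuous[OF flow, of "\<epsilon> - \<epsilon>'"] \<epsilon>'(1) by auto
  have "z \<in> bowen_ball X \<phi> t x \<epsilon>" if z: "z \<in> X" "dist z y < \<delta>" for z
    using bowen_ball_trans[OF \<epsilon>'(2) \<delta>(2)[of y z]] z y bowen_ball_subset by (fastforce simp: dist_commute)
  with \<delta>(1) show "\<exists>e>0. \<forall>x'\<in>X. dist x' y < e \<longrightarrow> x' \<in> bowen_ball X \<phi> t x \<epsilon>" by blast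
qed

lemma space_prob_measures: "\<mu> \<in> prob_measures X \<Longrightarrow> space \<mu> = X"
  using sets_eq_imp_space_eq[of \<mu> "restrict_space borel X"] by (simp add: prob_measures_def space_restrict_space)

lemma openin_sets_prob_measures:
  assumes "\<mu> \<in> prob_measures X" "openin (top_of_set X) U"
  shows "U \<in> sets \<mu>"
  using assms by (auto simp: prob_measures_def sets_restrict_space openin_open)

text \<open>Lower semicontinuity of the ball measure in its centre, the source of measurability
  below: a slightly smaller concentric ball already has mass above \<open>a\<close>, and it stays
  inside the ball about any nearby centre.\<close>

lemma openin_measure_bowen_ball_greater:
  assumes flow: "is_flow X \<phi>" and \<mu>: "\<mu> \<in> prob_measures X"
  shows "openin (top_of_set X) {x \<in> X. a < measure \<mu> (bowen_ball X \<phi> t x \<epsilon>)}"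
  unfolding openin_euclidean_subtopology_iff
proof (intro conjI ballI)
  interpret prob_space \<mu> using \<mu> by (simp add: prob_measures_def)
  fix x assume "x \<in> {x \<in> X. a < measure \<mu> (bowen_ball X \<phi> t x \<epsilon>)}"
  then have x: "x \<in> X" "a < measure \<mu> (bowen_ball X \<phi> t x \<epsilon>)" by auto
  define A where "A j = bowen_ball X \<phi> t x (\<epsilon> - 1 / real (Suc j))" for j
  have sets: "bowen_ball X \<phi> t z e \<in> sets \<mu>" if "z \<in> X" for z e
    by (intro openin_sets_prob_measures[OF \<mu>] openin_bowen_ball flow that)
  have "incseq A"
    unfolding A_def by (intro monoI bowen_ball_mono_radius) (simp add: field_simps)
  moreover have "(\<Union>j. A j) = bowen_ball X \<phi> t x \<epsilon>"
  proof (intro equalityI subsetI)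
    fix y assume "y \<in> bowen_ball X \<phi> t x \<epsilon>"
    then obtain \<epsilon>' where \<epsilon>': "\<epsilon>' < \<epsilon>" "y \<in> bowen_ball X \<phi> t x \<epsilon>'"
      by (rule bowen_ball_slack[OF flow x(1)])
    then obtain j where "inverse (real (Suc j)) < \<epsilon> - \<epsilon>'"
      using reals_Archimedean[of "\<epsilon> - \<epsilon>'"] by auto
    then have "\<epsilon>' \<le> \<epsilon> - 1 / real (Suc j)" by (simp add: inverse_eq_divide)
    then show "y \<in> (\<Union>j. A j)" unfolding A_def using \<epsilon>'(2) bowen_ball_mono_radius by fast
  next
    have "A j \<subseteq> bowen_ball X \<phi> t x \<epsilon>" for j
      unfolding A_def by (rule bowen_ball_mono_radius) simp
    then show "y \<in> bowen_ball X \<phi> t x \<epsilon>" if "y \<in> (\<Union>j. A j)" for y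
      using that by blast
  qed
  ultimately have "(\<lambda>j. measure \<mu> (A j)) \<longlonglongrightarrow> measure \<mu> (bowen_ball X \<phi> t x \<epsilon>)"
    using finite_Lim_measure_incseq[of A] sets x by (auto simp: A_def)
  then have "eventually (\<lambda>j. a < measure \<mu> (A j)) sequentially"
    using x(2) by (rule order_tendstoD)
  then obtain j where j: "a < measure \<mu> (A j)"
    by (auto simp: eventually_sequentially)
  define \<eta> where "\<eta> = 1 / real (Suc j)"
  obtain \<delta> where \<delta>: "0 < \<delta>" "\<And>x y. x \<in> X \<Longrightarrow> y \<in> X \<Longrightarrow> dist x y < \<delta> \<Longrightarrow> y \<in> bowen_ball X \<phi> t x \<eta>"
    using flow_equicontinuous[OF flow, of \<eta>] by (auto simp: \<eta>_def)
  have "a < measure \<mu> (bowen_ball X \<phi> t z \<epsilon>)" if z: "z \<in> X" "dist z x < \<delta>" for z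
  proof -
    have "A j \<subseteq> bowen_ball X \<phi> t z \<epsilon>"
      using bowen_ball_trans[OF \<delta>(2)[OF z(1) x(1) z(2)], of _ "\<epsilon> - \<eta>"] by (auto simp: A_def \<eta>_def)
    then have "measure \<mu> (A j) \<le> measure \<mu> (bowen_ball X \<phi> t z \<epsilon>)"
      by (intro finite_measure_mono sets z)
    with j show ?thesis by simp
  qed
  with \<delta>(1) show "\<exists>e>0. \<forall>x'\<in>X. dist x' x < e \<longrightarrow> x' \<in> {x \<in> X. a < measure \<mu> (bowen_ball X \<phi> t x \<epsilon>)}"
    by auto
qed auto

section \<open>Mass distribution and the upper bound for local entropy\<close>

lemma bowen_M_N_mono: "N \<le> N' \<Longrightarrow> bowen_M_N X \<phi> Z lam N \<epsilon> \<le> bowen_M_N X \<phi> Z lam N' \<epsilon>"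
  unfolding bowen_M_N_def by (intro INF_superset_mono) auto

lemma bowen_M_lam_eq_SUP: "bowen_M_lam X \<phi> Z lam \<epsilon> = (SUP N. bowen_M_N X \<phi> Z lam N \<epsilon>)"
  unfolding bowen_M_lam_def by (intro limI LIMSEQ_SUP monoI bowen_M_N_mono)

text \<open>A covering ball of radius \<open>\<epsilon> / 2\<close> that meets \<open>E\<close> lies
  in the \<open>\<epsilon>\<close>-ball about a point of \<open>E\<close>, whose mass is at most the
  cost of the covering ball. Balls missing \<open>E\<close> contribute nothing.\<close>

lemma mass_distribution_bowen:
  assumes flow: "is_flow X \<phi>" and \<mu>: "\<mu> \<in> prob_measures X" and K: "compact K" "K \<subseteq> X" "emeasure \<mu> K = 1"
    and E: "E \<in> sets \<mu>" "\<And>x n. x \<in> E \<Longrightarrow> N \<le> n \<Longrightarrow> measure \<mu> (bowen_ball X \<phi> (real n) x \<epsilon>) \<le> exp (- real n * lam)"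
  shows "emeasure \<mu> E \<le> bowen_M_N X \<phi> K lam N (\<epsilon> / 2)"
  unfolding bowen_M_N_def
proof (rule INF_greatest)
  interpret prob_space \<mu> using \<mu> by (simp add: prob_measures_def)
  have Ks: "K \<in> sets \<mu>"
    using K \<mu> by (auto simp: prob_measures_def sets_restrict_space borel_compact)
  have sets: "bowen_ball X \<phi> t z e \<in> sets \<mu>" if "z \<in> X" for z e t
    by (intro openin_sets_prob_measures[OF \<mu>] openin_bowen_ball flow that)
  fix C assume "C \<in> {C. countable C \<and> C \<subseteq> X \<times> {N..} \<and> K \<subseteq> (\<Union>(x, n)\<in>C. bowen_ball X \<phi> (real n) x (\<epsilon> / 2))}"
  then have C: "countable C" "C \<subseteq> X \<times> {N..}" "K \<subseteq> (\<Union>(x, n)\<in>C. bowen_ball X \<phi> (real n) x (\<epsilon> / 2))" by auto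
  define A where "A = (\<lambda>(x, n). E \<inter> bowen_ball X \<phi> (real n) x (\<epsilon> / 2))"
  have As: "A p \<in> sets \<mu>" if "p \<in> C" for p
    using that C(2) E(1) sets by (auto simp: A_def)
  have "AE x in \<mu>. x \<in> K" using K(3) Ks by (intro AE_prob_1) (simp add: emeasure_eq_measure)
  \<comment> \<open>The families cover only \<open>K\<close>, but \<open>K\<close> has full
    measure.\<close>
  then have "emeasure \<mu> E = emeasure \<mu> (E \<inter> K)"
    using E(1) Ks by (intro emeasure_eq_AE) auto
  also have "\<dots> \<le> emeasure \<mu> (\<Union>p\<in>C. A p)"
    using C As by (intro emeasure_mono sets.countable_UN') (force simp: A_def)+
  also have "\<dots> \<le> (\<integral>\<^sup>+ p. emeasure \<mu> (A p) \<partial>count_space C)"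
    using C(1) As by (rule emeasure_UN_le_count_space)
  also have "\<dots> \<le> (\<integral>\<^sup>+ p. ennreal (exp (- real (snd p) * lam)) \<partial>count_space C)"
  proof (intro nn_integral_mono)
    fix p assume p: "p \<in> space (count_space C)"
    then obtain x n where xn: "p = (x, n)" "x \<in> X" "N \<le> n" "p \<in> C" using C(2) by auto
    show "emeasure \<mu> (A p) \<le> ennreal (exp (- real (snd p) * lam))"
    proof (cases "A p = {}")
      case False
      then obtain y where y: "y \<in> E" "y \<in> bowen_ball X \<phi> (real n) x (\<epsilon> / 2)" by (auto simp: A_def xn)
      then have yX: "y \<in> X" using bowen_ball_subset by blast
      have "A p \<subseteq> bowen_ball X \<phi> (real n) y \<epsilon>"
        using bowen_ball_trans[OF bowen_ball_sym[OF xn(2) y(2)], of _ "\<epsilon> / 2"] by (auto simp: A_def xn)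
      then have "measure \<mu> (A p) \<le> measure \<mu> (bowen_ball X \<phi> (real n) y \<epsilon>)"
        by (intro finite_measure_mono sets yX)
      also have "\<dots> \<le> exp (- real n * lam)" using E(2) y xn by simp
      finally show ?thesis by (simp add: emeasure_eq_measure xn)
    qed simp
  qed
  finally show "emeasure \<mu> E \<le> (\<integral>\<^sup>+ p. ennreal (exp (- real (snd p) * lam)) \<partial>count_space C)" .
qed

text \<open>The points whose balls decay at rate \<open>lam\<close> from time \<open>N\<close> on
  form a null set by mass distribution. Hence almost every point violates the decay at arbitrarily
  large integer times, which caps the lower limit at \<open>lam\<close>.\<close>

lemma lower_BK_entropy_le:
  assumes flow: "is_flow X \<phi>" and \<mu>: "\<mu> \<in> prob_measures X" and K: "compact K" "K \<subseteq> X" "emeasure \<mu> K = 1"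
    and zero: "bowen_M_lam X \<phi> K lam (\<epsilon> / 2) = 0"
  shows "0 \<le> lam" "lower_BK_entropy X \<phi> \<mu> \<epsilon> \<le> ennreal lam"
proof -
  interpret prob_space \<mu> using \<mu> by (simp add: prob_measures_def)
  note space = space_prob_measures[OF \<mu>]
  define E where "E N = {x \<in> X. \<forall>n\<ge>N. measure \<mu> (bowen_ball X \<phi> (real n) x \<epsilon>) \<le> exp (- real n * lam)}" for N :: nat
  have E_sets: "E N \<in> sets \<mu>" for N
  proof -
    have "E N = space \<mu> - (\<Union>n\<in>{N..}. {x \<in> X. exp (- real n * lam) < measure \<mu> (bowen_ball X \<phi> (real n) x \<epsilon>)})"
      unfolding space E_def by (auto simp: not_less)
    also have "\<dots> \<in> sets \<mu>"
      using openin_sets_prob_measures[OF \<mu> openin_measure_bowen_ball_greater[OF flow \<mu>]]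
      by (intro sets.Diff sets.top sets.countable_UN') auto
    finally show ?thesis .
  qed
  have "emeasure \<mu> (E N) \<le> bowen_M_N X \<phi> K lam N (\<epsilon> / 2)" for N
    by (rule mass_distribution_bowen[OF flow \<mu> K E_sets]) (auto simp: E_def)
  moreover have "bowen_M_N X \<phi> K lam N (\<epsilon> / 2) \<le> bowen_M_lam X \<phi> K lam (\<epsilon> / 2)" for N
    unfolding bowen_M_lam_eq_SUP by (rule SUP_upper) simp
  ultimately have E0: "emeasure \<mu> (E N) = 0" for N
    using zero by (metis le_zero_eq order_trans)
  \<comment> \<open>A negative rate would put every point into \<open>E 0\<close>. The sign matters
    because \<open>ennreal\<close> truncates negative numbers.\<close>
  show lam: "0 \<le> lam"
  proof (rule ccontr)
    assume "\<not> 0 \<le> lam"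
    then have "1 \<le> exp (- real n * lam)" for n :: nat
      by (simp add: mult_nonneg_nonpos)
    then have "E 0 = X"
      unfolding E_def using prob_le_1 order_trans by blast
    then show False using E0[of 0] emeasure_space_1 by (simp add: space)
  qed
  have notE: "AE x in \<mu>. \<forall>N. x \<notin> E N"
    unfolding AE_all_countable using E0 E_sets by (auto intro!: AE_not_in simp: null_sets_def)
  have le: "Liminf at_top (bk_quot X \<phi> \<mu> \<epsilon> x) \<le> ennreal lam" if x: "x \<in> X" "\<forall>N. x \<notin> E N" for x
  proof (rule ccontr)
    assume "\<not> Liminf at_top (bk_quot X \<phi> \<mu> \<epsilon> x) \<le> ennreal lam"
    then have "eventually (\<lambda>t. ennreal lam < bk_quot X \<phi> \<mu> \<epsilon> x t) at_top"
      by (intro less_LiminfD) auto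
    then obtain t0 where t0: "\<And>t. t0 \<le> t \<Longrightarrow> ennreal lam < bk_quot X \<phi> \<mu> \<epsilon> x t"
      by (auto simp: eventually_at_top_linorder)
    \<comment> \<open>Integers from \<open>N\<close> on are beyond \<open>t0\<close> and positive,
      so the quotient may be multiplied out.\<close>
    define N where "N = nat \<lceil>max t0 1\<rceil>"
    have "measure \<mu> (bowen_ball X \<phi> (real n) x \<epsilon>) \<le> exp (- real n * lam)" if "N \<le> n" for n
    proof (cases "measure \<mu> (bowen_ball X \<phi> (real n) x \<epsilon>) = 0")
      case False
      let ?m = "measure \<mu> (bowen_ball X \<phi> (real n) x \<epsilon>)"
      have m: "0 < ?m" using False by (simp add: zero_less_measure_iff)
      have n: "t0 \<le> real n" "1 \<le> real n" using that unfolding N_def by linarith+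
      have "ennreal lam < ennreal (- (1 / real n) * ln ?m)"
        using t0[OF n(1)] False by (simp add: bk_quot_def)
      then have "lam < - (1 / real n) * ln ?m"
        using lam by (simp add: ennreal_less_iff)
      then have "ln ?m < - real n * lam"
        using n by (simp add: field_simps)
      then show ?thesis using m by (metis exp_less_cancel_iff exp_ln less_imp_le)
    qed simp
    then have "x \<in> E N" using x by (simp add: E_def)
    with x show False by blast
  qed
  have "AE x in \<mu>. Liminf at_top (bk_quot X \<phi> \<mu> \<epsilon> x) \<le> ennreal lam"
    using notE AE_space by eventually_elim (simp add: space le)
  then have "(\<integral>\<^sup>+ x. Liminf at_top (bk_quot X \<phi> \<mu> \<epsilon> x) \<partial>\<mu>) \<le> (\<integral>\<^sup>+ x. ennreal lam \<partial>\<mu>)"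
    by (rule nn_integral_mono_AE)
  then show "lower_BK_entropy X \<phi> \<mu> \<epsilon> \<le> ennreal lam"
    by (simp add: lower_BK_entropy_def emeasure_space_1)
qed

section \<open>Dynamical Frostman lemma\<close>

text \<open>Greedy selection: a point is added only if no chosen point is related to it.\<close>

lemma finite_maximal_separated:
  assumes "finite A" and sym: "\<And>x y. x \<in> A \<Longrightarrow> y \<in> A \<Longrightarrow> R x y \<Longrightarrow> R y x"
    and refl: "\<And>x. x \<in> A \<Longrightarrow> R x x"
  obtains E where "E \<subseteq> A" "pairwise (\<lambda>x y. \<not> R x y) E" "\<And>x. x \<in> A \<Longrightarrow> \<exists>e\<in>E. R e x"
proof -
  have "\<exists>E\<subseteq>A. pairwise (\<lambda>x y. \<not> R x y) E \<and> (\<forall>x\<in>A. \<exists>e\<in>E. R e x)"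
    using assms
  proof (induction A rule: finite_induct)
    case empty
    then show ?case by simp
  next
    case (insert a A)
    then obtain E where E: "E \<subseteq> A" "pairwise (\<lambda>x y. \<not> R x y) E" "\<forall>x\<in>A. \<exists>e\<in>E. R e x"
      by auto
    show ?case
    proof (cases "\<exists>e\<in>E. R e a")
      case True
      then show ?thesis using E by blast
    next
      case False
      then have "pairwise (\<lambda>x y. \<not> R x y) (insert a E)"
        using E(1,2) insert.prems(1) unfolding pairwise_insert by blast
      then show ?thesis using E insert.prems
        by (intro exI[of _ "insert a E"]) auto
    qed
  qed
  then show ?thesis using that by blast
qed

lemma finite_bowen_net:
  assumes flow: "is_flow X \<phi>" and K: "compact K" "K \<subseteq> X" and "0 < \<epsilon>"
  obtains F where "finite F" "F \<subseteq> K" "\<And>z. z \<in> K \<Longrightarrow> \<exists>x\<in>F. z \<in> bowen_ball X \<phi> t x \<epsilon>"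
proof -
  obtain \<delta> where \<delta>: "0 < \<delta>" "\<And>x y. x \<in> X \<Longrightarrow> y \<in> X \<Longrightarrow> dist x y < \<delta> \<Longrightarrow> y \<in> bowen_ball X \<phi> t x \<epsilon>"
    by (rule flow_equicontinuous[OF flow \<open>0 < \<epsilon>\<close>, where t = t]) blast
  obtain F where F: "F \<subseteq> K" "finite F" "K \<subseteq> (\<Union>x\<in>F. ball x \<delta>)"
    by (rule compactE_image[OF K(1), of K "\<lambda>x. ball x \<delta>"]) (use \<delta>(1) in auto)
  have "\<exists>x\<in>F. z \<in> bowen_ball X \<phi> t x \<epsilon>" if z: "z \<in> K" for z
  proof -
    obtain x where "x \<in> F" "dist x z < \<delta>" using F(3) z by auto
    then show ?thesis using \<delta>(2)[of x z] F(1) K(2) z by blast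
  qed
  with F that show ?thesis by blast
qed

text \<open>The weights minimise the energy of the kernel \<open>\<Sum>n. exp (n s) [y \<in> B\<^sub>n(x, \<epsilon>)]\<close>. The potential of the
  minimiser equals the energy \<open>I\<close> on the support, which bounds the mass of Bowen balls by \<open>I exp (-n s)\<close>;
  it is at least \<open>I\<close> on the whole net, which yields a Bowen cover of cost at most \<open>1 / I\<close>.\<close>

lemma frostman_pmf:
  assumes flow: "is_flow X \<phi>" and K: "compact K" "K \<noteq> {}" "K \<subseteq> X" and \<epsilon>: "0 < \<epsilon>" and "N \<le> T"
    and m: "0 < m" "ennreal m \<le> bowen_M_N X \<phi> K (s + 2 * \<delta>) N (3 * \<epsilon>)"
    and tail: "(\<Sum>n=N..T. exp (- real n * \<delta>)) \<le> 1"
  obtains p where "set_pmf p \<subseteq> K"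
    "\<And>n x. N \<le> n \<Longrightarrow> n \<le> T \<Longrightarrow> x \<in> X \<Longrightarrow>
      measure (measure_pmf p) (bowen_ball X \<phi> (real n) x (\<epsilon> / 2)) \<le> exp (- real n * s) / m"
proof -
  let ?B = "\<lambda>n x. bowen_ball X \<phi> (real n) x"
  \<comment> \<open>A net for the last time \<open>T\<close> is a net for all earlier times too, so
    passing from \<open>K\<close> to \<open>F\<close> costs a single \<open>\<epsilon>\<close> in
    the radius.\<close>
  obtain F where F: "finite F" "F \<subseteq> K" and net: "\<And>z. z \<in> K \<Longrightarrow> \<exists>x\<in>F. z \<in> ?B T x \<epsilon>"
    by (rule finite_bowen_net[OF flow K(1,3) \<epsilon>, where t = "real T"]) blast
  have FX: "x \<in> X" if "x \<in> F" for x using that F(2) K(3) by blast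
  have "F \<noteq> {}" using K(2) net by blast
  define k where "k x y = (\<Sum>n=N..T. exp (real n * s) * of_bool (y \<in> ?B n x \<epsilon>))" for x y
  have kernel_sym: "k x y = k y x" if "x \<in> F" "y \<in> F" for x y
  proof -
    have "y \<in> ?B n x \<epsilon> \<longleftrightarrow> x \<in> ?B n y \<epsilon>" for n
      using that FX bowen_ball_sym by metis
    then show ?thesis by (simp add: k_def)
  qed
  obtain w I where w: "w \<in> weights F"
    and potential_ge: "\<And>x. x \<in> F \<Longrightarrow> I \<le> (\<Sum>y\<in>F. w y * k x y)"
    and potential_eq: "\<And>x. x \<in> F \<Longrightarrow> 0 < w x \<Longrightarrow> (\<Sum>y\<in>F. w y * k x y) = I"
    by (rule energy_minimizer[OF F(1) \<open>F \<noteq> {}\<close> kernel_sym]) blast+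
  obtain p where p: "pmf p = w" "set_pmf p \<subseteq> F" and p_meas: "\<And>A. measure (measure_pmf p) A = sum w (A \<inter> F)"
    by (rule pmf_of_weights[OF F(1) w]) blast
  have p_sum: "measure (measure_pmf p) A = (\<Sum>y\<in>F. w y * of_bool (y \<in> A))" for A
    using F(1) by (simp add: p_meas Int_commute[of A] sum.inter_restrict of_bool_def if_distrib cong: if_cong)
  have potential: "(\<Sum>y\<in>F. w y * k x y) = (\<Sum>n=N..T. exp (real n * s) * measure (measure_pmf p) (?B n x \<epsilon>))" for x
  proof -
    have "(\<Sum>y\<in>F. w y * k x y) = (\<Sum>n=N..T. \<Sum>y\<in>F. exp (real n * s) * (w y * of_bool (y \<in> ?B n x \<epsilon>)))"
      unfolding k_def sum_distrib_left by (subst sum.swap) (simp add: mult.left_commute)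
    also have "\<dots> = (\<Sum>n=N..T. exp (real n * s) * measure (measure_pmf p) (?B n x \<epsilon>))"
      by (simp add: p_sum sum_distrib_left)
    finally show ?thesis .
  qed
  \<comment> \<open>On the support the potential is \<open>I\<close>, and each of its nonnegative
    summands is at most the whole.\<close>
  have ball_le: "exp (real n * s) * measure (measure_pmf p) (?B n x \<epsilon>) \<le> I"
    if "x \<in> set_pmf p" "N \<le> n" "n \<le> T" for x n
  proof -
    have "x \<in> F" "0 < w x"
      using that p w by (auto simp: set_pmf_eq weights_def less_le)
    then show ?thesis
      using member_le_sum[of n "{N..T}" "\<lambda>n. exp (real n * s) * measure (measure_pmf p) (?B n x \<epsilon>)"]
        that potential_eq potential by auto
  qed
  have I: "0 < I"
  proof -
    obtain x where x: "x \<in> set_pmf p" using set_pmf_not_empty[of p] by blast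
    have "x \<in> ?B N x \<epsilon>" using x p FX \<epsilon> by (intro bowen_ball_center) auto
    then have "0 < measure (measure_pmf p) (?B N x \<epsilon>)"
      using x by (auto simp: zero_less_measure_iff measure_pmf_zero_iff)
    then have "0 < exp (real N * s) * measure (measure_pmf p) (?B N x \<epsilon>)" by simp
    also have "\<dots> \<le> I" using x \<open>N \<le> T\<close> by (intro ball_le) auto
    finally show ?thesis .
  qed
  \<comment> \<open>The times at which a net point carries much mass. If all times failed at some
    point, its potential would be below \<open>I\<close> times the geometric tail, hence below
    \<open>I\<close>.\<close>
  define G where "G n = {x \<in> F. I * exp (- real n * (s + \<delta>)) \<le> measure (measure_pmf p) (?B n x \<epsilon>)}" for n
  have G_cover: "\<exists>n\<in>{N..T}. x \<in> G n" if x: "x \<in> F" for x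
  proof (rule ccontr)
    assume "\<not> ?thesis"
    then have small: "measure (measure_pmf p) (?B n x \<epsilon>) < I * exp (- real n * (s + \<delta>))" if "n \<in> {N..T}" for n
      using x that by (auto simp: G_def not_le)
    have "I \<le> (\<Sum>n=N..T. exp (real n * s) * measure (measure_pmf p) (?B n x \<epsilon>))"
      using potential_ge[OF x] potential by simp
    also have "\<dots> < (\<Sum>n=N..T. exp (real n * s) * (I * exp (- real n * (s + \<delta>))))"
      using \<open>N \<le> T\<close> small by (intro sum_strict_mono) auto
    also have "\<dots> = I * (\<Sum>n=N..T. exp (- real n * \<delta>))"
      by (simp add: sum_distrib_left mult.left_commute algebra_simps flip: exp_add)
    also have "\<dots> \<le> I" using I tail by (simp add: mult_le_cancel_left2)
    finally show False by simp
  qed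
  have "\<exists>E\<subseteq>G n. pairwise (\<lambda>x y. y \<notin> ?B n x (2 * \<epsilon>)) E \<and> (\<forall>x\<in>G n. \<exists>e\<in>E. x \<in> ?B n e (2 * \<epsilon>))" for n
  proof (rule finite_maximal_separated[of "G n" "\<lambda>x y. y \<in> ?B n x (2 * \<epsilon>)"])
    show "finite (G n)" using F(1) by (simp add: G_def)
  qed (use FX \<epsilon> in \<open>auto simp: G_def intro: bowen_ball_sym bowen_ball_center\<close>)
  then obtain E where E: "\<And>n. E n \<subseteq> G n" "\<And>n. pairwise (\<lambda>x y. y \<notin> ?B n x (2 * \<epsilon>)) (E n)"
    "\<And>n x. x \<in> G n \<Longrightarrow> \<exists>e\<in>E n. x \<in> ?B n e (2 * \<epsilon>)"
    by metis
  have EF: "E n \<subseteq> F" for n using E(1)[of n] by (auto simp: G_def)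
  have finE: "finite (E n)" for n using EF F(1) finite_subset by blast
  \<comment> \<open>Separation by \<open>2 * \<epsilon>\<close> makes the
    \<open>\<epsilon>\<close>-balls disjoint. Each has mass at least
    \<open>I * exp (- real n * (s + \<delta>))\<close>, and the total is at most 1.\<close>
  have card_E: "real (card (E n)) \<le> exp (real n * (s + \<delta>)) / I" for n
  proof -
    have "disjoint_family_on (\<lambda>x. ?B n x \<epsilon>) (E n)"
      unfolding disjoint_family_on_def
    proof (intro ballI impI)
      fix x y assume xy: "x \<in> E n" "y \<in> E n" "x \<noteq> y"
      have "y \<in> ?B n x (2 * \<epsilon>)" if "z \<in> ?B n x \<epsilon>" "z \<in> ?B n y \<epsilon>" for z
        using bowen_ball_trans[OF that(1) bowen_ball_sym[OF _ that(2)]] xy EF FX by auto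
      then show "?B n x \<epsilon> \<inter> ?B n y \<epsilon> = {}" using E(2)[of n] xy by (auto simp: pairwise_def)
    qed
    then have total: "(\<Sum>x\<in>E n. measure (measure_pmf p) (?B n x \<epsilon>)) = measure (measure_pmf p) (\<Union>x\<in>E n. ?B n x \<epsilon>)"
      using finE by (intro measure_pmf.finite_measure_finite_Union[symmetric]) auto
    have "real (card (E n)) * (I * exp (- (real n * (s + \<delta>)))) = (\<Sum>x\<in>E n. I * exp (- real n * (s + \<delta>)))"
      by simp
    also have "\<dots> \<le> (\<Sum>x\<in>E n. measure (measure_pmf p) (?B n x \<epsilon>))"
      using E(1)[of n] by (intro sum_mono) (auto simp: G_def)
    also have "\<dots> \<le> 1" unfolding total by (rule measure_pmf.prob_le_1)
    finally show ?thesis using I unfolding exp_minus by (simp add: divide_simps mult.commute mult.left_commute)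
  qed
  define C where "C = (\<lambda>(n, x). (x, n)) ` Sigma {N..T} E"
  have "finite C" unfolding C_def using finE by auto
  \<comment> \<open>The radius adds \<open>\<epsilon>\<close> for the net and
    \<open>2 * \<epsilon>\<close> for the maximal separated set.\<close>
  have cover: "K \<subseteq> (\<Union>(x, n)\<in>C. ?B n x (3 * \<epsilon>))"
  proof
    fix z assume "z \<in> K"
    then obtain x where x: "x \<in> F" "z \<in> ?B T x \<epsilon>" using net by blast
    obtain n where n: "n \<in> {N..T}" "x \<in> G n" using G_cover[OF x(1)] by blast
    then obtain e where e: "e \<in> E n" "x \<in> ?B n e (2 * \<epsilon>)" using E(3) by blast
    have "z \<in> ?B n x \<epsilon>" 
      by (rule subsetD[OF bowen_ball_antimono_time x(2)]) (use n in simp)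
    then have "z \<in> ?B n e (3 * \<epsilon>)" using bowen_ball_trans[OF e(2)] by fastforce
    then show "z \<in> (\<Union>(x, n)\<in>C. ?B n x (3 * \<epsilon>))" using e n by (force simp: C_def)
  qed
  have "ennreal m \<le> (\<integral>\<^sup>+ q. ennreal (exp (- real (snd q) * (s + 2 * \<delta>))) \<partial>count_space C)"
    using m(2) unfolding bowen_M_N_def
  proof (rule order.trans, intro INF_lower CollectI conjI)
    show "countable C" using \<open>finite C\<close> by (rule countable_finite)
    show "C \<subseteq> X \<times> {N..}" using EF FX by (auto simp: C_def)
  qed (use cover in auto)
  also have "\<dots> = ennreal (\<Sum>q\<in>C. exp (- real (snd q) * (s + 2 * \<delta>)))"
    using \<open>finite C\<close> by (simp add: nn_integral_count_space_finite)
  also have "(\<Sum>q\<in>C. exp (- real (snd q) * (s + 2 * \<delta>))) = (\<Sum>n=N..T. \<Sum>x\<in>E n. exp (- real n * (s + 2 * \<delta>)))"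
  proof -
    have "(\<Sum>q\<in>C. exp (- real (snd q) * (s + 2 * \<delta>))) = (\<Sum>(n, x)\<in>Sigma {N..T} E. exp (- real n * (s + 2 * \<delta>)))"
      unfolding C_def by (subst sum.reindex) (auto simp: inj_on_def case_prod_unfold)
    also have "\<dots> = (\<Sum>n=N..T. \<Sum>x\<in>E n. exp (- real n * (s + 2 * \<delta>)))"
      by (rule sum.Sigma[symmetric]) (auto simp: finE)
    finally show ?thesis .
  qed
  \<comment> \<open>The count grows at rate \<open>s + \<delta>\<close> and the cost decays at rate
    \<open>s + 2 * \<delta>\<close>; the spare \<open>\<delta>\<close> makes the sum over times at
    most \<open>1 / I\<close>.\<close>
  also have "\<dots> \<le> (\<Sum>n=N..T. exp (real n * (s + \<delta>)) / I * exp (- real n * (s + 2 * \<delta>)))"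
    by (intro sum_mono) (simp only: sum_constant, intro mult_right_mono card_E, simp)
  also have "\<dots> = (\<Sum>n=N..T. exp (- real n * \<delta>)) / I"
    by (simp add: sum_divide_distrib algebra_simps flip: exp_add)
  also have "\<dots> \<le> 1 / I" using tail I by (intro divide_right_mono) auto
  finally have "m \<le> 1 / I" using I by (simp add: ennreal_leI ennreal_le_iff)
  then have Im: "I \<le> 1 / m" using I m(1) by (simp add: field_simps)
  show ?thesis
  proof (rule that[of p])
    show "set_pmf p \<subseteq> K" using p F by blast
    fix n x assume n: "N \<le> n" "n \<le> T" and x: "x \<in> X"
    show "measure (measure_pmf p) (?B n x (\<epsilon> / 2)) \<le> exp (- real n * s) / m"
    \<comment> \<open>Halving the radius extends the bound from support points to arbitrary centres:
      a charged ball lies in the \<open>\<epsilon>\<close>-ball about a support point inside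
      it.\<close>
    proof (cases "set_pmf p \<inter> ?B n x (\<epsilon> / 2) = {}")
      case True
      then have "measure (measure_pmf p) (?B n x (\<epsilon> / 2)) = 0" by (simp add: measure_pmf_zero_iff)
      then show ?thesis using m(1) by simp
    next
      case False
      then obtain y where y: "y \<in> set_pmf p" "y \<in> ?B n x (\<epsilon> / 2)" by blast
      have "?B n x (\<epsilon> / 2) \<subseteq> ?B n y \<epsilon>"
        using bowen_ball_trans[OF bowen_ball_sym[OF x y(2)], of _ "\<epsilon> / 2"] by auto
      then have "measure (measure_pmf p) (?B n x (\<epsilon> / 2)) \<le> measure (measure_pmf p) (?B n y \<epsilon>)"
        by (intro measure_pmf.finite_measure_mono) auto
      also have "\<dots> \<le> exp (- real n * s) * I"
        using ball_le[OF y(1) n] by (simp add: exp_minus field_simps)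
      also have "\<dots> \<le> exp (- real n * s) * (1 / m)"
        using Im by (intro mult_left_mono) auto
      finally show ?thesis by simp
    qed
  qed
qed

text \<open>Rounding \<open>t\<close> down to an integer loses at most one unit of time, and the
  constant \<open>m\<close> enters only through \<open>ln m\<close>. Both disappear after division
  by \<open>t\<close>.\<close>

lemma lower_BK_entropy_ge:
  assumes \<mu>: "\<mu> \<in> prob_measures X" and m: "0 < m"
    and sets: "\<And>x t. x \<in> X \<Longrightarrow> bowen_ball X \<phi> t x \<epsilon> \<in> sets \<mu>"
    and ball: "\<And>n x. N \<le> n \<Longrightarrow> x \<in> X \<Longrightarrow> measure \<mu> (bowen_ball X \<phi> (real n) x \<epsilon>) \<le> exp (- real n * s) / m"
  shows "ennreal s \<le> lower_BK_entropy X \<phi> \<mu> \<epsilon>"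
proof (cases "0 \<le> s")
  case True
  interpret prob_space \<mu> using \<mu> by (simp add: prob_measures_def)
  note space = space_prob_measures[OF \<mu>]
  \<comment> \<open>The lower bound for the quotient at time \<open>t\<close>, using
    \<open>t - 1 \<le> real n\<close> and \<open>0 \<le> s\<close>.\<close>
  define h where "h t = (s * (t - 1) + ln m) / t" for t
  have "(h \<longlongrightarrow> s) at_top" unfolding h_def by real_asymp
  then have h: "((\<lambda>t. ennreal (h t)) \<longlongrightarrow> ennreal s) at_top" by (rule tendsto_ennrealI)
  have "ennreal s \<le> Liminf at_top (bk_quot X \<phi> \<mu> \<epsilon> x)" if x: "x \<in> X" for x
  proof -
    have "ennreal s = Liminf at_top (\<lambda>t. ennreal (h t))"
      using lim_imp_Liminf[OF _ h] by simp
    also have "\<dots> \<le> Liminf at_top (bk_quot X \<phi> \<mu> \<epsilon> x)"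
    proof (rule Liminf_mono)
      show "\<forall>\<^sub>F t in at_top. ennreal (h t) \<le> bk_quot X \<phi> \<mu> \<epsilon> x t"
        using eventually_ge_at_top[of "max 1 (real N)"]
      proof eventually_elim
        case (elim t)
        let ?m = "measure \<mu> (bowen_ball X \<phi> t x \<epsilon>)"
        define n where "n = nat \<lfloor>t\<rfloor>"
        have n: "N \<le> n" "real n \<le> t" "t - 1 \<le> real n"
          using elim unfolding n_def by linarith+
        show ?case
        proof (cases "?m = 0")
          case False
          then have pos: "0 < ?m" by (simp add: zero_less_measure_iff)
          have "?m \<le> measure \<mu> (bowen_ball X \<phi> (real n) x \<epsilon>)"
            using n sets x by (intro finite_measure_mono bowen_ball_antimono_time)
          also have "\<dots> \<le> exp (- real n * s) / m" using ball n x by blast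
          finally have "ln ?m \<le> ln (exp (- real n * s) / m)"
            using pos m by (subst ln_le_cancel_iff) auto
          also have "\<dots> = - real n * s - ln m" using m by (simp add: ln_div)
          also have "\<dots> \<le> - (s * (t - 1) + ln m)"
            using mult_right_mono[OF n(3) True] by (simp add: mult.commute)
          finally have "h t \<le> - (1 / t) * ln ?m"
            using elim by (simp add: h_def divide_simps)
          then show ?thesis using False by (simp add: bk_quot_def ennreal_leI)
        qed (simp add: bk_quot_def)
      qed
    qed
    finally show ?thesis .
  qed
  then have "(\<integral>\<^sup>+ x. ennreal s \<partial>\<mu>) \<le> (\<integral>\<^sup>+ x. Liminf at_top (bk_quot X \<phi> \<mu> \<epsilon> x) \<partial>\<mu>)"
    by (intro nn_integral_mono) (simp add: space)
  then show ?thesis by (simp add: lower_BK_entropy_def emeasure_space_1)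
qed (simp add: ennreal_neg)

text \<open>The finite-horizon measures of \<open>frostman_pmf\<close> are passed to a weak limit as
  the horizon grows.\<close>

lemma frostman_bowen:
  assumes flow: "is_flow X \<phi>" and K: "compact K" "K \<noteq> {}" "K \<subseteq> X" and \<epsilon>: "0 < \<epsilon>" and \<delta>: "0 < \<delta>"
    and nonzero: "bowen_M_lam X \<phi> K (s + 2 * \<delta>) (3 * \<epsilon>) \<noteq> 0"
  obtains \<mu> where "\<mu> \<in> prob_measures X" "emeasure \<mu> K = 1" "ennreal s \<le> lower_BK_entropy X \<phi> \<mu> (\<epsilon> / 2)"
proof -
  obtain N0 where N0: "0 < bowen_M_N X \<phi> K (s + 2 * \<delta>) N0 (3 * \<epsilon>)"
  proof -
    have "0 < (SUP N. bowen_M_N X \<phi> K (s + 2 * \<delta>) N (3 * \<epsilon>))"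
      using nonzero by (simp add: bowen_M_lam_eq_SUP zero_less_iff_neq_zero)
    then show ?thesis using that by (auto simp: less_SUP_iff)
  qed
  define q where "q = exp (- \<delta>)"
  have q: "0 < q" "q < 1" using \<delta> by (auto simp: q_def)
  \<comment> \<open>Starting late enough makes the geometric tail at most 1; raising
    \<open>N\<close> keeps \<open>bowen_M_N\<close> positive by monotonicity.\<close>
  have "eventually (\<lambda>N. q ^ N / (1 - q) < 1) sequentially"
    using q by real_asymp
  then obtain N where N: "N0 \<le> N" "q ^ N / (1 - q) < 1"
    unfolding eventually_sequentially by (metis max.cobounded1 max.cobounded2)
  have tail: "(\<Sum>n=N..T. exp (- real n * \<delta>)) \<le> 1" for T
  proof (cases "N \<le> T")
    case True
    have "(\<Sum>n=N..T. exp (- real n * \<delta>)) = (\<Sum>n=N..T. q ^ n)"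
      by (simp add: q_def flip: exp_of_nat_mult)
    also have "\<dots> = (q ^ N - q ^ Suc T) / (1 - q)"
      using q True by (simp add: sum_gp)
    also have "\<dots> \<le> q ^ N / (1 - q)" using q by (intro divide_right_mono) auto
    finally show ?thesis using N(2) by simp
  qed simp
  have "0 < bowen_M_N X \<phi> K (s + 2 * \<delta>) N (3 * \<epsilon>)"
    using N0 bowen_M_N_mono[OF N(1)] by (rule less_le_trans)
  \<comment> \<open>The premeasure may be infinite, in which case any positive real serves.\<close>
  then obtain m where m: "0 < m" "ennreal m \<le> bowen_M_N X \<phi> K (s + 2 * \<delta>) N (3 * \<epsilon>)"
    by (cases "bowen_M_N X \<phi> K (s + 2 * \<delta>) N (3 * \<epsilon>)") (auto intro: zero_less_one)
  \<comment> \<open>Horizon \<open>max N T\<close> gives a measure for every \<open>T\<close>,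
    including those below \<open>N\<close>.\<close>
  have "\<forall>T. \<exists>p. set_pmf p \<subseteq> K \<and> (\<forall>n x. N \<le> n \<longrightarrow> n \<le> max N T \<longrightarrow> x \<in> X \<longrightarrow>
      measure (measure_pmf p) (bowen_ball X \<phi> (real n) x (\<epsilon> / 2)) \<le> exp (- real n * s) / m)"
  proof
    fix T
    show "\<exists>p. set_pmf p \<subseteq> K \<and> (\<forall>n x. N \<le> n \<longrightarrow> n \<le> max N T \<longrightarrow> x \<in> X \<longrightarrow>
        measure (measure_pmf p) (bowen_ball X \<phi> (real n) x (\<epsilon> / 2)) \<le> exp (- real n * s) / m)"
      by (rule frostman_pmf[OF flow K \<epsilon> _ m tail, of "max N T"]) auto
  qed
  then obtain p where "\<forall>T. set_pmf (p T) \<subseteq> K \<and> (\<forall>n x. N \<le> n \<longrightarrow> n \<le> max N T \<longrightarrow> x \<in> X \<longrightarrow>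
      measure (measure_pmf (p T)) (bowen_ball X \<phi> (real n) x (\<epsilon> / 2)) \<le> exp (- real n * s) / m)"
    unfolding choice_iff by blast
  then have p: "\<And>T. set_pmf (p T) \<subseteq> K" and p_le: "\<And>T n x. N \<le> n \<Longrightarrow> n \<le> max N T \<Longrightarrow> x \<in> X \<Longrightarrow>
      measure (measure_pmf (p T)) (bowen_ball X \<phi> (real n) x (\<epsilon> / 2)) \<le> exp (- real n * s) / m"
    by blast+
  obtain \<mu> where \<mu>: "\<mu> \<in> prob_measures X" "emeasure \<mu> K = 1"
    and lim: "\<And>U C. openin (top_of_set X) U \<Longrightarrow> eventually (\<lambda>T. measure (measure_pmf (p T)) U \<le> C) sequentially
      \<Longrightarrow> measure \<mu> U \<le> C"
    by (rule pmf_weak_limit_on_compact[OF K, of p]) (use p in blast)+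
  have "measure \<mu> (bowen_ball X \<phi> (real n) x (\<epsilon> / 2)) \<le> exp (- real n * s) / m" if "N \<le> n" "x \<in> X" for n x
  \<comment> \<open>For fixed \<open>n\<close> the bound holds once \<open>T\<close> is at least
    \<open>n\<close>, and the ball is relatively open.\<close>
  proof (rule lim[OF openin_bowen_ball[OF flow that(2)]])
    show "\<forall>\<^sub>F T in sequentially. measure (measure_pmf (p T)) (bowen_ball X \<phi> (real n) x (\<epsilon> / 2)) \<le> exp (- real n * s) / m"
      using eventually_ge_at_top[of n] by eventually_elim (rule p_le[OF that(1) _ that(2)], simp)
  qed
  then have "ennreal s \<le> lower_BK_entropy X \<phi> \<mu> (\<epsilon> / 2)"
    by (intro lower_BK_entropy_ge[OF \<mu>(1) m(1)] openin_sets_prob_measures[OF \<mu>(1)] openin_bowen_ball[OF flow])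
  with \<mu> show ?thesis by (rule that)
qed

section \<open>The variational principle\<close>

text \<open>The ratio of \<open>ln (1 / (c * \<epsilon>))\<close> to
  \<open>ln (1 / \<epsilon>)\<close> tends to 1, so a constant factor in the scale is
  invisible.\<close>

lemma Limsup_div_ln_rescale_le:
  fixes A B :: "real \<Rightarrow> ereal"
  assumes c: "0 < c" and le: "\<And>\<epsilon>. 0 < \<epsilon> \<Longrightarrow> A \<epsilon> \<le> B (c * \<epsilon>)"
  shows "Limsup (at_right 0) (\<lambda>\<epsilon>. A \<epsilon> / ereal (ln (1 / \<epsilon>)))
       \<le> Limsup (at_right 0) (\<lambda>\<epsilon>. B \<epsilon> / ereal (ln (1 / \<epsilon>)))" (is "?A \<le> ?B")
\<comment> \<open>Testing against real upper bounds \<open>a\<close> avoids arithmetic with infinite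
  limits; the extra \<open>e\<close> yields the strict inequality that holds eventually.\<close>
proof (rule ereal_le_real)
  fix a assume a: "?B \<le> ereal a"
  show "?A \<le> ereal a"
  proof (rule ereal_le_epsilon2)
    fix e :: real assume e: "0 < e"
    define b where "b = a + e"
    have "?B < ereal b"
      using a e by (metis b_def ereal_less(2) ereal_less_eq(3) less_add_same_cancel1 less_ereal.simps(1) order.strict_trans1)
    then have "eventually (\<lambda>\<epsilon>. B \<epsilon> / ereal (ln (1 / \<epsilon>)) < ereal b) (at_right 0)"
      by (rule Limsup_lessD)
    moreover have "filterlim (\<lambda>\<epsilon>. c * \<epsilon>) (at_right 0) (at_right (0::real))"
      using c by real_asymp
    ultimately have 1: "eventually (\<lambda>\<epsilon>. B (c * \<epsilon>) / ereal (ln (1 / (c * \<epsilon>))) < ereal b) (at_right 0)"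
      by (rule eventually_compose_filterlim)
    have 2: "eventually (\<lambda>\<epsilon>. 0 < ln (1 / (c * \<epsilon>))) (at_right 0)"
      using c by real_asymp
    have 3: "eventually (\<lambda>\<epsilon>. 0 < ln (1 / \<epsilon>)) (at_right (0::real))"
      by real_asymp
    have pos: "eventually (\<lambda>\<epsilon>. 0 < \<epsilon>) (at_right (0::real))"
      by (simp add: eventually_at_right_less)
    have "((\<lambda>\<epsilon>. b * ln (1 / (c * \<epsilon>)) / ln (1 / \<epsilon>)) \<longlongrightarrow> b) (at_right 0)"
      using c by real_asymp
    then have lim: "((\<lambda>\<epsilon>. ereal (b * ln (1 / (c * \<epsilon>)) / ln (1 / \<epsilon>))) \<longlongrightarrow> ereal b) (at_right 0)"
      by simp
    have "?A \<le> Limsup (at_right 0) (\<lambda>\<epsilon>. ereal (b * ln (1 / (c * \<epsilon>)) / ln (1 / \<epsilon>)))"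
    proof (rule Limsup_mono, use 1 2 3 pos in eventually_elim)
      case (elim \<epsilon>)
      have "A \<epsilon> \<le> ereal (b * ln (1 / (c * \<epsilon>)))"
      proof -
        have "B (c * \<epsilon>) \<le> ereal (b * ln (1 / (c * \<epsilon>)))"
          using elim(1,2) by (cases "B (c * \<epsilon>)") (auto simp: field_simps)
        then show ?thesis using le[OF elim(4)] by order
      qed
      then show ?case
        using elim(3) by (cases "A \<epsilon>") (auto simp: field_simps)
    qed
    also have "\<dots> = ereal b"
      using lim by (rule lim_imp_Limsup[rotated]) simp
    finally show "?A \<le> ereal a + ereal e" by (simp add: b_def)
  qed
qed

definition sup_BK_entropy :: "'a::metric_space set \<Rightarrow> ('a \<Rightarrow> real \<Rightarrow> 'a) \<Rightarrow> 'a set \<Rightarrow> real \<Rightarrow> ereal" where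
  "sup_BK_entropy X \<phi> K \<epsilon> =
    enn2ereal (SUP \<mu> \<in> {\<mu> \<in> prob_measures X. emeasure \<mu> K = 1}. lower_BK_entropy X \<phi> \<mu> \<epsilon>)"

lemma sup_BK_entropy_le_bowen_M:
  assumes flow: "is_flow X \<phi>" and K: "compact K" "K \<noteq> {}" "K \<subseteq> X"
  shows "sup_BK_entropy X \<phi> K \<epsilon> \<le> bowen_M X \<phi> K (\<epsilon> / 2)"
  unfolding bowen_M_def
proof (rule INF_greatest)
  fix lam assume "lam \<in> {lam. bowen_M_lam X \<phi> K lam (\<epsilon> / 2) = 0}"
  then have zero: "bowen_M_lam X \<phi> K lam (\<epsilon> / 2) = 0" by simp
  obtain x where "x \<in> K" using K by blast
  \<comment> \<open>A point mass, as limit of a constant sequence. Some admissible measure must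
    exist to conclude \<open>0 \<le> lam\<close>.\<close>
  obtain \<mu> where "\<mu> \<in> prob_measures X" "emeasure \<mu> K = 1"
    by (rule pmf_weak_limit_on_compact[OF K, of "\<lambda>_. return_pmf x"]) (use \<open>x \<in> K\<close> in auto)
  then have lam: "0 \<le> lam" using lower_BK_entropy_le(1)[OF flow _ K(1,3) _ zero] by blast
  have "(SUP \<mu> \<in> {\<mu> \<in> prob_measures X. emeasure \<mu> K = 1}. lower_BK_entropy X \<phi> \<mu> \<epsilon>) \<le> ennreal lam"
    by (rule SUP_least) (use lower_BK_entropy_le(2)[OF flow _ K(1,3) _ zero] in blast)
  then show "sup_BK_entropy X \<phi> K \<epsilon> \<le> ereal lam"
    unfolding sup_BK_entropy_def using lam by (metis enn2ereal_ennreal less_eq_ennreal.rep_eq)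
qed

lemma bowen_M_le_sup_BK_entropy:
  assumes flow: "is_flow X \<phi>" and K: "compact K" "K \<noteq> {}" "K \<subseteq> X" and \<epsilon>: "0 < \<epsilon>"
  shows "bowen_M X \<phi> K (6 * \<epsilon>) \<le> sup_BK_entropy X \<phi> K \<epsilon>"
proof (rule ccontr)
  assume "\<not> ?thesis"
  then obtain lam where lam: "sup_BK_entropy X \<phi> K \<epsilon> < ereal lam" "ereal lam < bowen_M X \<phi> K (6 * \<epsilon>)"
    using ereal_dense2 by (auto simp: not_le)
  then obtain s where s: "sup_BK_entropy X \<phi> K \<epsilon> < ereal s" "s < lam"
    using ereal_dense2 by (metis less_ereal.simps(1))
  \<comment> \<open>Chosen so that \<open>s + 2 * \<delta> = lam\<close>. The Frostman lemma is used
    at scale \<open>2 * \<epsilon>\<close>: its radii become \<open>6 * \<epsilon>\<close> for the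
    cover and \<open>\<epsilon>\<close> for the entropy.\<close>
  define \<delta> where "\<delta> = (lam - s) / 2"
  have "bowen_M_lam X \<phi> K lam (6 * \<epsilon>) \<noteq> 0"
  proof
    assume "bowen_M_lam X \<phi> K lam (6 * \<epsilon>) = 0"
    then have "bowen_M X \<phi> K (6 * \<epsilon>) \<le> ereal lam"
      unfolding bowen_M_def by (intro Inf_lower) auto
    with lam(2) show False by simp
  qed
  then have nonzero: "bowen_M_lam X \<phi> K (s + 2 * \<delta>) (3 * (2 * \<epsilon>)) \<noteq> 0"
    by (simp add: \<delta>_def field_simps)
  have "0 < 2 * \<epsilon>" "0 < \<delta>" using \<epsilon> s by (auto simp: \<delta>_def)
  then obtain \<mu> where \<mu>: "\<mu> \<in> prob_measures X" "emeasure \<mu> K = 1" "ennreal s \<le> lower_BK_entropy X \<phi> \<mu> (2 * \<epsilon> / 2)"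
    by (rule frostman_bowen[OF flow K _ _ nonzero])
  have "ennreal s \<le> (SUP \<mu> \<in> {\<mu> \<in> prob_measures X. emeasure \<mu> K = 1}. lower_BK_entropy X \<phi> \<mu> \<epsilon>)"
    using \<mu> by (intro SUP_upper2[of \<mu>]) auto
  then have "enn2ereal (ennreal s) \<le> sup_BK_entropy X \<phi> K \<epsilon>"
    unfolding sup_BK_entropy_def by (simp add: less_eq_ennreal.rep_eq)
  \<comment> \<open>Truncation of a negative \<open>s\<close> to 0 only increases it.\<close>
  moreover have "ereal s \<le> enn2ereal (ennreal s)"
    by (cases "0 \<le> s") (auto simp: enn2ereal_ennreal ennreal_neg zero_ennreal.rep_eq)
  ultimately show False using s(1) by order
qed

theorem theorem1p2:
  fixes X K :: "'a::metric_space set" and \<phi> :: "'a \<Rightarrow> real \<Rightarrow> 'a"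
  assumes "is_flow X \<phi>" and "K \<subseteq> X" and "K \<noteq> {}" and "compact K"
  shows "bowen_upper_mdim X \<phi> K =
    Limsup (at_right 0) (\<lambda>\<epsilon>. (1 / ereal (ln (1 / \<epsilon>))) *
       enn2ereal (SUP \<mu> \<in> {\<mu> \<in> prob_measures X. emeasure \<mu> K = 1}. lower_BK_entropy X \<phi> \<mu> \<epsilon>))"
proof -
  have "bowen_upper_mdim X \<phi> K = Limsup (at_right 0) (\<lambda>\<epsilon>. sup_BK_entropy X \<phi> K \<epsilon> / ereal (ln (1 / \<epsilon>)))"
    unfolding bowen_upper_mdim_def
  proof (rule antisym)
    show "Limsup (at_right 0) (\<lambda>\<epsilon>. bowen_M X \<phi> K \<epsilon> / ereal (ln (1 / \<epsilon>)))
        \<le> Limsup (at_right 0) (\<lambda>\<epsilon>. sup_BK_entropy X \<phi> K \<epsilon> / ereal (ln (1 / \<epsilon>)))"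
      \<comment> \<open>Replacing the scale by a sixth of itself turns the factor 6 on the left into
        \<open>c = 1 / 6\<close> on the right.\<close>
      using bowen_M_le_sup_BK_entropy[OF assms(1,4,3,2), of "_ / 6"]
      by (intro Limsup_div_ln_rescale_le[where c = "1 / 6"]) auto
    show "Limsup (at_right 0) (\<lambda>\<epsilon>. sup_BK_entropy X \<phi> K \<epsilon> / ereal (ln (1 / \<epsilon>)))
        \<le> Limsup (at_right 0) (\<lambda>\<epsilon>. bowen_M X \<phi> K \<epsilon> / ereal (ln (1 / \<epsilon>)))"
      using sup_BK_entropy_le_bowen_M[OF assms(1,4,3,2)]
      by (intro Limsup_div_ln_rescale_le[where c = "1 / 2"]) auto
  qed
  then show ?thesis
    by (simp add: sup_BK_entropy_def divide_ereal_def mult.commute)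
qed

end
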